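(* Let $c\in(0,\tfrac12)$ be a constant. There exist constants $0<K_1\le K_2<\infty$ depending only on $c$ such that for every integer $n\ge 2$ and every $\lambda\in(0,\tfrac12-c]$ the following hold. (1) In the noisy sorting model with sampling model $(O_1)$ (sampling without replacement) with parameter $p\in(0,1]$, $$K_1\Big(\frac{n}{p\lambda^2}\wedge n^2\Big)\le \min_{\tilde\pi}\ \max_{\pi^*\in\mathfrak S_n,\ M\in\mathcal M_n(\lambda)}\ \mathbb E_{\pi^*,M}\big[d_{\mathsf{KT}}(\tilde\pi,\pi^* )\big]\le K_2\Big(\frac{n}{p\lambda^2}\wedge n^2\Big).$$ (2) In the noisy sorting model with sampling model $(O_2)$ (sampling with replacement) with $N$ comparisons, where $1\le N\le\binom n2$, $$K_1\Big(\frac{n^3}{N\lambda^2}\wedge n^2\Big)\le \min_{\tilde\pi}\ \max_{\pi^*\in\mathfrak S_n,\ M\in\mathcal M_n(\lambda)}\ \mathbb E_{\pi^*,M}\big[d_{\mathsf{KT}}(\tilde\pi,\pi^* )\big]\le K_2\Big(\frac{n^3}{N\lambda^2}\wedge n^2\Big).$$ In both cases the minimum is over all estimators $\tilde\pi\in\mathfrak S_n$ that are measurable with respect to the observations (they may depend on the known parameters $n,\lambda$ and $p$ or $N$), and $\max$ is understood as a supremum over $M$.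
   Context: $\mathfrak S_n$ is the set of permutations of $[n]=\{1,\dots,n\}$; $a\wedge b=\min(a,b)$. The Kendall tau distance is $d_{\mathsf{KT}}(\pi,\sigma)=\sum_{(i,j):\sigma(i)<\sigma(j)}\mathbf 1(\pi(i)>\pi(j))$, the number of discordant pairs. For $\lambda\in(0,1/2)$, $\mathcal M_n(\lambda)$ is the set of matrices $M\in[0,1]^{n\times n}$ with $M_{i,i}=\tfrac12$, $M_{i,j}\ge\tfrac12+\lambda$ if $i>j$, $M_{i,j}\le\tfrac12-\lambda$ if $i<j$. As $M_{i,j}$ are comparison probabilities, $M_{i,j}+M_{j,i}=1$. Noisy sorting model: there is an unknown permutation $\pi^*\in\mathfrak S_n$ and a matrix $M\in\mathcal M_n(\lambda)$. Each unordered pair $\{i,j\}$, $i\ne j$, of items is compared $N_{i,j}=N_{j,i}\ge0$ times, and in each comparison item $i$ beats item $j$ with probability $M_{\pi^*(i),\pi^*(j)}$ (otherwise $j$ beats $i$), all outcomes being independent given the $N_{i,j}$. The observations are the counts $N_{i,j}$ and $A_{i,j}$, where $A_{i,j}$ is the number of times $i$ beats $j$ (so $A_{i,j}+A_{j,i}=N_{i,j}$, $A_{i,i}=0$). Sampling model $(O_1)$ (without replacement): the $N_{i,j}$, $i<j$, are independent $\mathrm{Bernoulli}(p)$ variables. Sampling model $(O_2)$ (with replacement): $N$ comparisons are made, their pairs being sampled uniformly and independently with replacement from the $\binom n2$ pairs. $\mathbb E_{\pi^*,M}$ is expectation under the law of the observations with parameters $\pi^*$ and $M$. *)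

theory Defs
  imports "HOL-Probability.Probability" "HOL-Probability.Product_PMF" "HOL-Combinatorics.Permutations"
begin

text \<open>
  Items are the elements of \<open>{1..n}\<close>; permutations are functions \<open>\<pi>\<close> with \<open>\<pi> permutes {1..n}\<close>;
  matrices are functions \<open>nat \<Rightarrow> nat \<Rightarrow> real\<close> of which only the entries with
  indices in \<open>{1..n}\<close> are ever used.
\<close>

definition kendall_tau :: "nat \<Rightarrow> (nat \<Rightarrow> nat) \<Rightarrow> (nat \<Rightarrow> nat) \<Rightarrow> nat" where
  "kendall_tau n \<pi> \<sigma> =
     (\<Sum>(i, j) \<in> {(i, j) \<in> {1..n} \<times> {1..n}. \<sigma> i < \<sigma> j}. of_bool (\<pi> i > \<pi> j))"

definition comparison_matrices :: "nat \<Rightarrow> real \<Rightarrow> (nat \<Rightarrow> nat \<Rightarrow> real) set" where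
  "comparison_matrices n lam =
     {M. \<forall>i\<in>{1..n}. \<forall>j\<in>{1..n}.
           0 \<le> M i j \<and> M i j \<le> 1 \<and>
           M i j + M j i = 1 \<and>
           (i = j \<longrightarrow> M i j = 1/2) \<and>
           (i > j \<longrightarrow> M i j \<ge> 1/2 + lam) \<and>
           (i < j \<longrightarrow> M i j \<le> 1/2 - lam)}"

text \<open>The unordered pair \<open>{i, j}\<close> is represented by \<open>(i, j)\<close> with \<open>i < j\<close>.\<close>

definition item_pairs :: "nat \<Rightarrow> (nat \<times> nat) set" where
  "item_pairs n = {(i, j). 1 \<le> i \<and> i < j \<and> j \<le> n}"

text \<open>The two sampling models, as laws of the number of comparisons of each pair.\<close>

definition sampling_O1 :: "nat \<Rightarrow> real \<Rightarrow> (nat \<times> nat \<Rightarrow> nat) pmf" where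
  "sampling_O1 n p = Pi_pmf (item_pairs n) 0 (\<lambda>_. map_pmf of_bool (bernoulli_pmf p))"

definition sampling_O2 :: "nat \<Rightarrow> nat \<Rightarrow> (nat \<times> nat \<Rightarrow> nat) pmf" where
  "sampling_O2 n N =
     map_pmf (\<lambda>s q. card {t. t < N \<and> s t = q})
       (Pi_pmf {..<N} (0, 0) (\<lambda>_. pmf_of_set (item_pairs n)))"

text \<open>
  Given the numbers of comparisons \<open>c\<close>, the outcome \<open>w ((i, j), k)\<close> says whether
  \<open>i\<close> beats \<open>j\<close> in the \<open>k\<close>-th comparison of the pair \<open>(i, j)\<close>, \<open>i < j\<close>.
\<close>

definition outcomes ::
  "nat \<Rightarrow> (nat \<Rightarrow> nat) \<Rightarrow> (nat \<Rightarrow> nat \<Rightarrow> real) \<Rightarrow> (nat \<times> nat \<Rightarrow> nat)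
     \<Rightarrow> ((nat \<times> nat) \<times> nat \<Rightarrow> bool) pmf" where
  "outcomes n \<pi> M c =
     Pi_pmf (SIGMA q : item_pairs n. {..<c q}) False
       (\<lambda>((i, j), k). bernoulli_pmf (M (\<pi> i) (\<pi> j)))"

text \<open>The observation consists of the matrices \<open>N\<close> (comparisons) and \<open>A\<close> (wins of \<open>i\<close> over \<open>j\<close>).\<close>

type_synonym observation = "(nat \<Rightarrow> nat \<Rightarrow> nat) \<times> (nat \<Rightarrow> nat \<Rightarrow> nat)"

text \<open>
  On the diagonal both entries are \<open>0\<close>, because \<open>c (i, i) = 0\<close> in both sampling models.
\<close>

definition observe :: "(nat \<times> nat \<Rightarrow> nat) \<Rightarrow> ((nat \<times> nat) \<times> nat \<Rightarrow> bool) \<Rightarrow> observation" where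
  "observe c w =
     ((\<lambda>i j. c (min i j, max i j)),
      (\<lambda>i j. if i < j then card {k. k < c (i, j) \<and> w ((i, j), k)}
             else card {k. k < c (j, i) \<and> \<not> w ((j, i), k)}))"

definition observation_law ::
  "nat \<Rightarrow> (nat \<times> nat \<Rightarrow> nat) pmf \<Rightarrow> (nat \<Rightarrow> nat) \<Rightarrow> (nat \<Rightarrow> nat \<Rightarrow> real) \<Rightarrow> observation pmf" where
  "observation_law n S \<pi> M =
     bind_pmf S (\<lambda>c. map_pmf (observe c) (outcomes n \<pi> M c))"

text \<open>The observation is discrete, so every function of it is measurable.\<close>

definition estimators :: "nat \<Rightarrow> (observation \<Rightarrow> nat \<Rightarrow> nat) set" where
  "estimators n = {est. \<forall>x. est x permutes {1..n}}"

definition risk ::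
  "nat \<Rightarrow> (nat \<times> nat \<Rightarrow> nat) pmf \<Rightarrow> (observation \<Rightarrow> nat \<Rightarrow> nat)
     \<Rightarrow> (nat \<Rightarrow> nat) \<Rightarrow> (nat \<Rightarrow> nat \<Rightarrow> real) \<Rightarrow> real" where
  "risk n S est \<pi> M =
     measure_pmf.expectation (observation_law n S \<pi> M) (\<lambda>x. real (kendall_tau n (est x) \<pi>))"

definition worst_risk ::
  "nat \<Rightarrow> real \<Rightarrow> (nat \<times> nat \<Rightarrow> nat) pmf \<Rightarrow> (observation \<Rightarrow> nat \<Rightarrow> nat) \<Rightarrow> real" where
  "worst_risk n lam S est =
     (SUP (\<pi>, M) \<in> {\<pi>. \<pi> permutes {1..n}} \<times> comparison_matrices n lam. risk n S est \<pi> M)"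

definition minimax_risk :: "nat \<Rightarrow> real \<Rightarrow> (nat \<times> nat \<Rightarrow> nat) pmf \<Rightarrow> real" where
  "minimax_risk n lam S = (INF est \<in> estimators n. worst_risk n lam S est)"

text \<open>
  The supremum and infimum above are over nonempty bounded sets of reals, and the infimum
  is attained, i.e. is a minimum.
\<close>

lemma finite_item_pairs [simp]: "finite (item_pairs n)"
  by (rule finite_subset[of _ "{1..n} \<times> {1..n}"]) (auto simp: item_pairs_def)

lemma finite_set_pmf_sampling_O1: "finite (set_pmf (sampling_O1 n p))"
  unfolding sampling_O1_def by (subst set_Pi_pmf) (auto intro!: finite_PiE_dflt)

lemma finite_set_pmf_sampling_O2:
  assumes "n \<ge> 2" shows "finite (set_pmf (sampling_O2 n N))"
proof -
  have "(1, 2) \<in> item_pairs n" using assms by (auto simp: item_pairs_def)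
  then have "item_pairs n \<noteq> {}" by blast
  then show ?thesis
    unfolding sampling_O2_def by (auto simp: set_Pi_pmf intro!: finite_PiE_dflt)
qed

lemma comparison_matrices_nonempty:
  assumes "0 < lam" "lam < 1/2" shows "comparison_matrices n lam \<noteq> {}"
proof -
  have "(\<lambda>i j. if i > j then 1/2 + lam else if i < j then 1/2 - lam else 1/2) \<in> comparison_matrices n lam"
    using assms by (auto simp: comparison_matrices_def)
  then show ?thesis by blast
qed

lemma kendall_tau_le: "kendall_tau n \<pi> \<sigma> \<le> n\<^sup>2"
proof -
  let ?P = "{(i, j) \<in> {1..n} \<times> {1..n}. \<sigma> i < \<sigma> j}"
  have "kendall_tau n \<pi> \<sigma> \<le> (\<Sum>_\<in>?P. 1)"
    unfolding kendall_tau_def by (rule sum_mono) auto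
  also have "\<dots> = card ?P" by simp
  also have "\<dots> \<le> card ({1..n} \<times> {1..n})" by (rule card_mono) auto
  finally show ?thesis by (simp add: power2_eq_square)
qed

lemma risk_le: "risk n S est \<pi> M \<le> real (n\<^sup>2)"
proof -
  have "risk n S est \<pi> M \<le> measure_pmf.expectation (observation_law n S \<pi> M) (\<lambda>_. real (n\<^sup>2))"
    unfolding risk_def
    by (intro integral_mono measure_pmf.integrable_const_bound[where B = "real (n\<^sup>2)"])
      (use kendall_tau_le[of n] in \<open>auto simp del: of_nat_power\<close>)
  then show ?thesis by simp
qed

lemma bdd_above_risk:
  "bdd_above ((\<lambda>(\<pi>, M). risk n S est \<pi> M) ` ({\<pi>. \<pi> permutes {1..n}} \<times> comparison_matrices n lam))"
  using risk_le[of n S est] by (intro bdd_aboveI2[where M = "real (n\<^sup>2)"]) auto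

lemma minimax_risk_attained:
  assumes "finite (set_pmf S)"
  shows "\<exists>est\<in>estimators n. worst_risk n lam S est = minimax_risk n lam S
           \<and> (\<forall>est'\<in>estimators n. worst_risk n lam S est \<le> worst_risk n lam S est')"
proof -
  define X where "X = (\<Union>c\<in>set_pmf S. observe c `
      PiE_dflt (SIGMA q : item_pairs n. {..<c q}) False (\<lambda>_. UNIV))"
  have finX: "finite X"
    unfolding X_def using assms by (auto intro!: finite_PiE_dflt)
  have supp: "set_pmf (observation_law n S \<pi> M) \<subseteq> X" for \<pi> M
    unfolding observation_law_def outcomes_def X_def
    by (fastforce simp: set_Pi_pmf PiE_dflt_def)
  have restr: "worst_risk n lam S est = worst_risk n lam S (restrict est X)" for est
  proof -
    have "risk n S est \<pi> M = risk n S (restrict est X) \<pi> M" for \<pi> M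
      unfolding risk_def
      by (rule integral_cong_AE) (use supp in \<open>auto simp: AE_measure_pmf_iff\<close>)
    then have "risk n S est = risk n S (restrict est X)" by (intro ext)
    then show ?thesis
      unfolding worst_risk_def
      by (rule arg_cong[where f = "\<lambda>r. SUP (\<pi>, M) \<in> _. r \<pi> M"])
  qed
  let ?W = "worst_risk n lam S ` estimators n"
  have "?W \<subseteq> worst_risk n lam S ` (X \<rightarrow>\<^sub>E {\<pi>. \<pi> permutes {1..n}})"
  proof
    fix r assume "r \<in> ?W"
    then obtain est where est: "est \<in> estimators n" and r: "r = worst_risk n lam S est" by blast
    have "restrict est X \<in> X \<rightarrow>\<^sub>E {\<pi>. \<pi> permutes {1..n}}"
      using est by (auto simp: estimators_def)
    then show "r \<in> worst_risk n lam S ` (X \<rightarrow>\<^sub>E {\<pi>. \<pi> permutes {1..n}})"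
      using r restr[of est] by blast
  qed
  then have fin: "finite ?W"
    by (rule finite_subset) (auto intro!: finite_PiE finX finite_permutations)
  have "(\<lambda>_. id) \<in> estimators n" by (auto simp: estimators_def permutes_id)
  then have ne: "?W \<noteq> {}" by blast
  have eq: "minimax_risk n lam S = Min ?W"
    unfolding minimax_risk_def using fin ne by (rule cInf_eq_Min)
  have "Min ?W \<in> ?W" using fin ne by (rule Min_in)
  then obtain est where est: "est \<in> estimators n" "worst_risk n lam S est = Min ?W"
    by (metis imageE)
  moreover have "\<forall>est'\<in>estimators n. Min ?W \<le> worst_risk n lam S est'"
    using fin by (auto intro: Min_le)
  ultimately show ?thesis using eq by auto
qed

end

theory Submission
  imports Defs
begin

text \<open>
  Both sampling models enter only through the generating function of the comparison counts, with
  \<open>p = N / (n choose 2)\<close> for sampling with replacement, so both rates are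
  \<open>min (n / (p * lam\<^sup>2)) (n\<^sup>2)\<close>.

  Upper bound: maximise the number of agreeing comparisons over a sieve of permutations, one for
  each coarsening of the ranks to blocks of length about \<open>1 / p\<close>. At distance \<open>r\<close> from the truth
  the score drifts by \<open>lam p r\<close>, whereas by chaining over coarsenings at geometric scales the
  noise over the ball of radius \<open>r\<close> is of order \<open>sqrt (n p r)\<close>; these balance at
  \<open>r = n / (p * lam\<^sup>2)\<close>. A one-step union bound over the sieve would lose a logarithm.

  Lower bound: under the uniform prior on permutations, exchanging two items of ranks at most
  \<open>m = 1 / (p * lam\<^sup>2)\<close> apart changes the law of only \<open>O(m)\<close> pairs, so that the relative
  order of these two items is misjudged with probability bounded below.
\<close>

section \<open>Kendall tau, footrule and coarsened permutations\<close>

text \<open>The upper bound is shaped by sparsity. A pair is compared about \<open>p\<close> times,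
  so its margin has Poisson-like tails and its exponential moments are controlled only for
  parameters up to 1. Chaining down to single ranks would need larger parameters; blocks of length
  \<open>1 / p\<close> are the finest that can be reached. The price is a bias of order
  \<open>n\<close>, while at the target distance the drift is already of order
  \<open>n / lam\<close>. The logarithm disappears because, near the truth, block displacements are
  integer vectors of small \<open>L1\<close> norm: level \<open>l\<close> has only
  \<open>exp (O (n * (l + 1)))\<close> of them, and its links are short enough to pay for that
  number. The score needs neither \<open>M\<close> nor \<open>lam\<close>.

  The lower bound needs no packing of permutations: Kendall tau is a sum over pairs, so a two-point
  test for each pair suffices, and every permutation has of order \<open>n * min m n\<close> pairs
  with ranks at most \<open>m\<close> apart. The constant \<open>c\<close> enters quantitatively
  through \<open>1 - 4 * lam\<^sup>2 \<ge> 2 * c\<close>, which keeps single comparisons from being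
  nearly deterministic.\<close>

definition ranks_above :: "(nat \<Rightarrow> nat) \<Rightarrow> nat \<times> nat \<Rightarrow> bool" where
  "ranks_above \<pi> q \<longleftrightarrow> \<pi> (snd q) < \<pi> (fst q)"

text \<open>With unordered pairs, symmetry and the triangle inequality become set algebra, and the
  same set is the support of score differences and of likelihood ratios.\<close>

definition discordant :: "nat \<Rightarrow> (nat \<Rightarrow> nat) \<Rightarrow> (nat \<Rightarrow> nat) \<Rightarrow> (nat \<times> nat) set" where
  "discordant n \<pi> \<sigma> = {q \<in> item_pairs n. ranks_above \<pi> q \<noteq> ranks_above \<sigma> q}"

text \<open>Spearman's footrule, the \<open>L1\<close> distance of rank vectors. Being a sum over
  items, it suits rounding to blocks and lattice point counts.\<close>

definition footrule :: "nat \<Rightarrow> (nat \<Rightarrow> nat) \<Rightarrow> (nat \<Rightarrow> nat) \<Rightarrow> int" where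
  "footrule n \<pi> \<sigma> = (\<Sum>i\<in>{1..n}. \<bar>int (\<pi> i) - int (\<sigma> i)\<bar>)"

lemma finite_discordant [simp]: "finite (discordant n \<pi> \<sigma>)"
  unfolding discordant_def by simp

lemma card_discordant_triangle:
  "card (discordant n \<pi> \<tau>) \<le> card (discordant n \<pi> \<sigma>) + card (discordant n \<sigma> \<tau>)"
proof -
  have "discordant n \<pi> \<tau> \<subseteq> discordant n \<pi> \<sigma> \<union> discordant n \<sigma> \<tau>"
    by (auto simp: discordant_def)
  then have "card (discordant n \<pi> \<tau>) \<le> card (discordant n \<pi> \<sigma> \<union> discordant n \<sigma> \<tau>)"
    by (intro card_mono) auto
  also have "\<dots> \<le> card (discordant n \<pi> \<sigma>) + card (discordant n \<sigma> \<tau>)"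
    by (rule card_Un_le)
  finally show ?thesis .
qed

lemma discordant_commute: "discordant n \<pi> \<sigma> = discordant n \<sigma> \<pi>"
  by (auto simp: discordant_def)

lemma kendall_tau_eq_card:
  "kendall_tau n \<pi> \<sigma> = card {(i, j) \<in> {1..n} \<times> {1..n}. \<sigma> i < \<sigma> j \<and> \<pi> j < \<pi> i}"
proof -
  let ?P = "{(i, j) \<in> {1..n} \<times> {1..n}. \<sigma> i < \<sigma> j}"
  have "finite ?P" by (rule finite_subset[of _ "{1..n} \<times> {1..n}"]) auto
  moreover have "kendall_tau n \<pi> \<sigma> = (\<Sum>q\<in>?P. of_bool (\<pi> (snd q) < \<pi> (fst q)))"
    unfolding kendall_tau_def by (intro sum.cong) auto
  ultimately have "kendall_tau n \<pi> \<sigma> = card (?P \<inter> {q. \<pi> (snd q) < \<pi> (fst q)})"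
    by simp
  also have "?P \<inter> {q. \<pi> (snd q) < \<pi> (fst q)} =
      {(i, j) \<in> {1..n} \<times> {1..n}. \<sigma> i < \<sigma> j \<and> \<pi> j < \<pi> i}" by auto
  finally show ?thesis .
qed

text \<open>Kendall tau counts ordered pairs oriented by \<open>\<sigma>\<close>; sorting each by
  item label is a bijection onto the unordered discordant pairs.\<close>

lemma kendall_tau_eq_card_discordant:
  assumes "\<pi> permutes {1..n}" "\<sigma> permutes {1..n}"
  shows "kendall_tau n \<pi> \<sigma> = card (discordant n \<pi> \<sigma>)"
proof -
  let ?K = "{(i, j) \<in> {1..n} \<times> {1..n}. \<sigma> i < \<sigma> j \<and> \<pi> j < \<pi> i}"
  let ?f = "\<lambda>(i, j). (min i j, max i j) :: nat \<times> nat"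
  have inj: "\<pi> i = \<pi> j \<longleftrightarrow> i = j" "\<sigma> i = \<sigma> j \<longleftrightarrow> i = j" for i j
    using assms by (auto dest: permutes_inj injD)
  have "inj_on ?f ?K"
    by (auto simp: inj_on_def min_def max_def split: if_splits)
  moreover have "?f ` ?K = discordant n \<pi> \<sigma>"
  proof (intro equalityI subsetI)
    fix q assume "q \<in> ?f ` ?K"
    then obtain i j where "q = (min i j, max i j)" "i \<in> {1..n}" "j \<in> {1..n}" "\<sigma> i < \<sigma> j" "\<pi> j < \<pi> i"
      by auto
    moreover from this have "i \<noteq> j" by auto
    ultimately show "q \<in> discordant n \<pi> \<sigma>"
      by (auto simp: discordant_def item_pairs_def ranks_above_def min_def max_def)
  next
    fix q assume q: "q \<in> discordant n \<pi> \<sigma>"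
    obtain i j where ij: "q = (i, j)" by fastforce
    have *: "i \<in> {1..n}" "j \<in> {1..n}" "i < j" "(\<pi> j < \<pi> i) \<noteq> (\<sigma> j < \<sigma> i)"
      using q ij by (auto simp: discordant_def item_pairs_def ranks_above_def)
    show "q \<in> ?f ` ?K"
    proof (cases "\<pi> j < \<pi> i")
      case True
      then have "\<sigma> i < \<sigma> j" using * inj(2)[of i j] by auto
      then have "(i, j) \<in> ?K" using * True by auto
      moreover have "?f (i, j) = q" using * ij by auto
      ultimately show ?thesis by (metis (no_types, lifting) image_eqI)
    next
      case False
      then have "\<sigma> j < \<sigma> i" "\<pi> i < \<pi> j" using * inj(1)[of i j] by auto
      then have "(j, i) \<in> ?K" using * by auto
      moreover have "?f (j, i) = q" using * ij by auto
      ultimately show ?thesis by (metis (no_types, lifting) image_eqI)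
    qed
  qed
  ultimately have "bij_betw ?f ?K (discordant n \<pi> \<sigma>)" by (simp add: bij_betw_def)
  then show ?thesis
    by (simp add: kendall_tau_eq_card bij_betw_same_card)
qed

lemma permutes_card_le:
  assumes "\<pi> permutes {1..n}" "i \<in> {1..n}"
  shows "card {j \<in> {1..n}. \<pi> j \<le> \<pi> i} = \<pi> i"
proof -
  have im: "\<pi> ` {1..n} = {1..n}" and inj: "inj \<pi>"
    using assms(1) by (auto simp: permutes_image permutes_inj)
  have "\<pi> i \<le> n" using im assms(2) by auto
  have "\<pi> ` {j \<in> {1..n}. \<pi> j \<le> \<pi> i} = {1..\<pi> i}"
  proof (intro equalityI subsetI)
    fix x assume "x \<in> {1..\<pi> i}"
    then have "x \<in> \<pi> ` {1..n}" using \<open>\<pi> i \<le> n\<close> im by auto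
    then show "x \<in> \<pi> ` {j \<in> {1..n}. \<pi> j \<le> \<pi> i}" using \<open>x \<in> {1..\<pi> i}\<close> by auto
  next
    fix x assume "x \<in> \<pi> ` {j \<in> {1..n}. \<pi> j \<le> \<pi> i}"
    moreover then have "x \<in> {1..n}" using im by blast
    ultimately show "x \<in> {1..\<pi> i}" by auto
  qed
  then have "card {1..\<pi> i} = card {j \<in> {1..n}. \<pi> j \<le> \<pi> i}"
    using inj by (metis card_image inj_on_subset subset_UNIV)
  then show ?thesis by simp
qed

text \<open>One of the Diaconis-Graham inequalities. A rank counts the items ranked no higher, so
  two ranks of \<open>i\<close> differ by at most the symmetric difference \<open>?D i\<close> of
  two such sets. Summed over \<open>i\<close>, every discordant pair is seen at most once from each
  end, whence the factor 2.\<close>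

lemma footrule_le_kendall_tau:
  assumes "\<pi> permutes {1..n}" "\<sigma> permutes {1..n}"
  shows "footrule n \<pi> \<sigma> \<le> 2 * int (kendall_tau n \<pi> \<sigma>)"
proof -
  let ?D = "\<lambda>i. {j \<in> {1..n}. (\<pi> j \<le> \<pi> i) \<noteq> (\<sigma> j \<le> \<sigma> i)}"
  let ?K = "{(i, j) \<in> {1..n} \<times> {1..n}. \<sigma> i < \<sigma> j \<and> \<pi> j < \<pi> i}"
  have inj: "\<pi> i = \<pi> j \<longleftrightarrow> i = j" "\<sigma> i = \<sigma> j \<longleftrightarrow> i = j" for i j
    using assms by (auto dest: permutes_inj injD)
  have pt: "\<bar>int (\<pi> i) - int (\<sigma> i)\<bar> \<le> int (card (?D i))" if i: "i \<in> {1..n}" for i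
  proof -
    let ?A = "{j \<in> {1..n}. \<pi> j \<le> \<pi> i}" and ?B = "{j \<in> {1..n}. \<sigma> j \<le> \<sigma> i}"
    have "card ?A \<le> card (?B \<union> ?D i)" by (intro card_mono) auto
    moreover have "card ?B \<le> card (?A \<union> ?D i)" by (intro card_mono) auto
    moreover have "card (?B \<union> ?D i) \<le> card ?B + card (?D i)"
      "card (?A \<union> ?D i) \<le> card ?A + card (?D i)" by (rule card_Un_le)+
    ultimately show ?thesis
      using permutes_card_le[OF assms(1) i] permutes_card_le[OF assms(2) i] by linarith
  qed
  have finK: "finite ?K" by (rule finite_subset[of _ "{1..n} \<times> {1..n}"]) auto
  have "footrule n \<pi> \<sigma> \<le> (\<Sum>i\<in>{1..n}. int (card (?D i)))"
    unfolding footrule_def by (intro sum_mono pt)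
  also have "\<dots> = int (card (SIGMA i:{1..n}. ?D i))" by simp
  also have "(SIGMA i:{1..n}. ?D i) \<subseteq> ?K \<union> prod.swap ` ?K"
  proof
    fix q assume "q \<in> (SIGMA i:{1..n}. ?D i)"
    then obtain i j where ij: "q = (i, j)" "i \<in> {1..n}" "j \<in> {1..n}" "(\<pi> j \<le> \<pi> i) \<noteq> (\<sigma> j \<le> \<sigma> i)"
      by auto
    then have "i \<noteq> j" by auto
    then have "(i, j) \<in> ?K \<or> (j, i) \<in> ?K"
      using ij inj[of i j] by auto
    then show "q \<in> ?K \<union> prod.swap ` ?K" using ij by force
  qed
  then have "card (SIGMA i:{1..n}. ?D i) \<le> card (?K \<union> prod.swap ` ?K)"
    using finK by (intro card_mono) auto
  also have "\<dots> \<le> card ?K + card (prod.swap ` ?K)" by (rule card_Un_le)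
  also have "card (prod.swap ` ?K) \<le> card ?K" using finK by (rule card_image_le)
  finally show ?thesis by (simp add: kendall_tau_eq_card)
qed

lemma card_preimage_le:
  assumes "inj f" "finite B"
  shows "card {j \<in> A. f j \<in> B} \<le> card B"
  using assms by (intro card_inj_on_le[of f]) (auto intro: inj_on_subset)

text \<open>A discordant pair \<open>\<sigma> i < \<sigma> j\<close>, \<open>\<pi> j < \<pi> i\<close> either has \<open>\<sigma> j \<in> (\<sigma> i, \<pi> i]\<close>,
  and is then charged to \<open>i\<close>, or \<open>\<pi> i \<in> (\<pi> j, \<sigma> j)\<close>, and is charged to \<open>j\<close>.\<close>

lemma kendall_tau_le_footrule:
  assumes "\<pi> permutes {1..n}" "\<sigma> permutes {1..n}"
  shows "int (kendall_tau n \<pi> \<sigma>) \<le> 2 * footrule n \<pi> \<sigma>"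
proof -
  let ?K = "{(i, j) \<in> {1..n} \<times> {1..n}. \<sigma> i < \<sigma> j \<and> \<pi> j < \<pi> i}"
  let ?A = "\<lambda>i. {j \<in> {1..n}. \<sigma> j \<in> {\<sigma> i<..\<pi> i}}"
  let ?B = "\<lambda>j. {i \<in> {1..n}. \<pi> i \<in> {\<pi> j<..<\<sigma> j}}"
  have inj: "inj \<pi>" "inj \<sigma>" using assms by (auto simp: permutes_inj)
  have "?K \<subseteq> (SIGMA i:{1..n}. ?A i) \<union> prod.swap ` (SIGMA j:{1..n}. ?B j)"
    by (auto simp: image_iff)
  then have "card ?K \<le> card ((SIGMA i:{1..n}. ?A i) \<union> prod.swap ` (SIGMA j:{1..n}. ?B j))"
    by (intro card_mono) auto
  also have "\<dots> \<le> card (SIGMA i:{1..n}. ?A i) + card (prod.swap ` (SIGMA j:{1..n}. ?B j))"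
    by (rule card_Un_le)
  also have "card (prod.swap ` (SIGMA j:{1..n}. ?B j)) \<le> card (SIGMA j:{1..n}. ?B j)"
    by (rule card_image_le) auto
  also have "card (SIGMA i:{1..n}. ?A i) = (\<Sum>i\<in>{1..n}. card (?A i))" by simp
  also have "card (SIGMA i:{1..n}. ?B i) = (\<Sum>i\<in>{1..n}. card (?B i))" by simp
  finally have "int (card ?K) \<le> (\<Sum>i\<in>{1..n}. int (card (?A i)) + int (card (?B i)))"
    by (simp add: sum.distrib flip: of_nat_sum of_nat_add)
  also have "\<dots> \<le> (\<Sum>i\<in>{1..n}. 2 * \<bar>int (\<pi> i) - int (\<sigma> i)\<bar>)"
  proof (rule sum_mono)
    fix i
    have "card (?A i) \<le> \<pi> i - \<sigma> i" "card (?B i) \<le> \<sigma> i - \<pi> i"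
      using card_preimage_le[OF inj(2), of "{\<sigma> i<..\<pi> i}" "{1..n}"]
        card_preimage_le[OF inj(1), of "{\<pi> i<..<\<sigma> i}" "{1..n}"] by auto
    moreover have "int a + int b \<le> 2 * \<bar>int x - int y\<bar>" if "a \<le> x - y" "b \<le> y - x" for a b x y
      using that by (cases "x \<le> y") auto
    ultimately show "int (card (?A i)) + int (card (?B i)) \<le> 2 * \<bar>int (\<pi> i) - int (\<sigma> i)\<bar>"
      by blast
  qed
  finally show ?thesis by (simp add: kendall_tau_eq_card footrule_def sum_distrib_left)
qed

section \<open>Coarsening ranks to blocks\<close>

definition coarsen :: "nat \<Rightarrow> nat \<Rightarrow> (nat \<Rightarrow> nat) \<Rightarrow> nat \<Rightarrow> nat" where
  "coarsen n s \<pi> = (SOME \<tau>. \<tau> permutes {1..n} \<and> (\<forall>i\<in>{1..n}. \<tau> i div s = \<pi> i div s))"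

lemma coarsen:
  assumes "\<pi> permutes {1..n}"
  shows coarsen_permutes: "coarsen n s \<pi> permutes {1..n}"
    and coarsen_div: "i \<in> {1..n} \<Longrightarrow> coarsen n s \<pi> i div s = \<pi> i div s"
proof -
  have "coarsen n s \<pi> permutes {1..n} \<and> (\<forall>i\<in>{1..n}. coarsen n s \<pi> i div s = \<pi> i div s)"
    unfolding coarsen_def by (rule someI[of _ \<pi>]) (use assms in auto)
  then show "coarsen n s \<pi> permutes {1..n}"
    and "i \<in> {1..n} \<Longrightarrow> coarsen n s \<pi> i div s = \<pi> i div s" by auto
qed

text \<open>The choice in \<open>coarsen\<close> sees \<open>\<pi>\<close> only through its block
  numbers, so equal block numbers give the same representative, not merely an equivalent
  one.\<close>

lemma coarsen_cong:
  assumes "\<And>i. i \<in> {1..n} \<Longrightarrow> \<pi> i div s = \<sigma> i div s"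
  shows "coarsen n s \<pi> = coarsen n s \<sigma>"
  unfolding coarsen_def using assms by (intro arg_cong[where f = Eps] ext) auto

text \<open>Blocks of length \<open>s * k\<close> are unions of blocks of length \<open>s\<close>.
  Hence the next coarser point of a chain is a function of the current one, and the chain
  telescopes.\<close>

lemma coarsen_coarsen:
  assumes "\<pi> permutes {1..n}"
  shows "coarsen n (s * k) (coarsen n s \<pi>) = coarsen n (s * k) \<pi>"
  by (rule coarsen_cong) (simp add: div_mult2_eq coarsen_div[OF assms])

lemma card_discordant_coarsen:
  assumes "\<pi> permutes {1..n}" "s > 0"
  shows "card (discordant n \<pi> (coarsen n s \<pi>)) \<le> 2 * n * s"
proof -
  let ?\<tau> = "coarsen n s \<pi>"
  have "footrule n \<pi> ?\<tau> \<le> (\<Sum>i\<in>{1..n}. int s)"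
    unfolding footrule_def
  proof (rule sum_mono)
    fix i assume i: "i \<in> {1..n}"
    have "\<pi> i = s * (\<pi> i div s) + \<pi> i mod s" "?\<tau> i = s * (\<pi> i div s) + ?\<tau> i mod s"
      using coarsen_div[OF assms(1) i, of s] by (metis mult_div_mod_eq)+
    moreover have "\<pi> i mod s < s" "?\<tau> i mod s < s" using assms(2) by simp_all
    moreover have "\<bar>int x - int y\<bar> \<le> int s" if "x = k + a" "y = k + b" "a < s" "b < s" for x y k a b
      using that by linarith
    ultimately show "\<bar>int (\<pi> i) - int (?\<tau> i)\<bar> \<le> int s" by blast
  qed
  then have "int (kendall_tau n \<pi> ?\<tau>) \<le> int (2 * n * s)"
    using kendall_tau_le_footrule[OF assms(1) coarsen_permutes[OF assms(1), of s]] by simp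
  then show ?thesis
    using kendall_tau_eq_card_discordant[OF assms(1) coarsen_permutes[OF assms(1), of s]]
    by linarith
qed

section \<open>Counting coarsened permutations near a given one\<close>

lemma sum_exp_neg_abs_le:
  fixes \<theta> :: real
  assumes "0 < \<theta>" "\<theta> \<le> 1"
  shows "(\<Sum>v\<in>{- int B..int B}. exp (- \<theta> * \<bar>real_of_int v\<bar>)) \<le> 4 / \<theta>"
proof -
  let ?g = "\<lambda>v::int. exp (- \<theta> * \<bar>real_of_int v\<bar>)"
  have "{- int B..int B} \<subseteq> int ` {..B} \<union> (\<lambda>k. - int k) ` {..B}"
  proof
    fix v assume "v \<in> {- int B..int B}"
    then show "v \<in> int ` {..B} \<union> (\<lambda>k. - int k) ` {..B}"
      by (cases v rule: int_cases2) (auto simp: image_iff)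
  qed
  then have "sum ?g {- int B..int B} \<le> sum ?g (int ` {..B} \<union> (\<lambda>k. - int k) ` {..B})"
    by (intro sum_mono2) auto
  also have "\<dots> \<le> sum ?g (int ` {..B}) + sum ?g ((\<lambda>k. - int k) ` {..B})"
    by (subst sum_Un) (auto intro!: sum_nonneg)
  also have "sum ?g (int ` {..B}) = (\<Sum>k\<le>B. exp (- \<theta>) ^ k)"
    by (subst sum.reindex) (auto simp: inj_on_def mult.commute exp_of_nat_mult[symmetric])
  also have "sum ?g ((\<lambda>k. - int k) ` {..B}) = (\<Sum>k\<le>B. exp (- \<theta>) ^ k)"
    by (subst sum.reindex) (auto simp: inj_on_def mult.commute exp_of_nat_mult[symmetric])
  also have "(\<Sum>k\<le>B. exp (- \<theta>) ^ k) \<le> 2 / \<theta>"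
  proof -
    have e: "exp (- \<theta>) < 1" using assms by simp
    have "1 + \<theta> \<le> exp \<theta>" by (rule exp_ge_add_one_self)
    then have "exp (- \<theta>) \<le> 1 / (1 + \<theta>)"
      using assms by (simp add: exp_minus inverse_eq_divide divide_left_mono frac_le)
    also have "\<dots> \<le> 1 - \<theta> / 2"
    proof -
      have "\<theta> * \<theta> \<le> \<theta>" using assms by (simp add: mult_left_le)
      then show ?thesis using assms by (simp add: field_simps)
    qed
    finally have h: "\<theta> / 2 \<le> 1 - exp (- \<theta>)" by simp
    have "(\<Sum>k\<le>B. exp (- \<theta>) ^ k) = (1 - exp (- \<theta>) ^ Suc B) / (1 - exp (- \<theta>))"
      using e by (subst sum_gp0) auto
    also have "\<dots> \<le> 1 / (1 - exp (- \<theta>))"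
      using e by (intro divide_right_mono) auto
    also have "\<dots> \<le> 1 / (\<theta> / 2)" using h assms by (intro divide_left_mono) auto
    finally show ?thesis by simp
  qed
  finally show ?thesis by simp
qed

text \<open>A generating function bound: every counted vector has weight at least \<open>1\<close> under
  \<open>f \<mapsto> exp (\<theta> (X - \<Sum>\<bar>f i\<bar>))\<close>, and these weights factorise.\<close>

lemma card_bounded_l1_le:
  fixes \<theta> X :: real
  assumes "0 < \<theta>" "\<theta> \<le> 1" "finite I"
  assumes G: "G \<subseteq> {f \<in> I \<rightarrow>\<^sub>E {- int B..int B}. (\<Sum>i\<in>I. \<bar>real_of_int (f i)\<bar>) \<le> X}"
  shows "real (card G) \<le> exp (\<theta> * X) * (4 / \<theta>) ^ card I"
proof -
  have finE: "finite (I \<rightarrow>\<^sub>E {- int B..int B})" using assms(3) by (intro finite_PiE) auto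
  have "real (card G) = (\<Sum>f\<in>G. 1)" by simp
  also have "\<dots> \<le> (\<Sum>f\<in>G. exp (\<theta> * X) * (\<Prod>i\<in>I. exp (- \<theta> * \<bar>real_of_int (f i)\<bar>)))"
  proof (rule sum_mono)
    fix f assume "f \<in> G"
    then have "(\<Sum>i\<in>I. \<bar>real_of_int (f i)\<bar>) \<le> X" using G by auto
    then have "0 \<le> \<theta> * (X - (\<Sum>i\<in>I. \<bar>real_of_int (f i)\<bar>))" using assms by simp
    also have "\<dots> = \<theta> * X + (\<Sum>i\<in>I. - \<theta> * \<bar>real_of_int (f i)\<bar>)"
      by (simp add: right_diff_distrib sum_distrib_left sum_negf)
    finally show "1 \<le> exp (\<theta> * X) * (\<Prod>i\<in>I. exp (- \<theta> * \<bar>real_of_int (f i)\<bar>))"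
      using assms(3) by (simp flip: exp_sum exp_add)
  qed
  also have "\<dots> \<le> (\<Sum>f\<in>I \<rightarrow>\<^sub>E {- int B..int B}.
      exp (\<theta> * X) * (\<Prod>i\<in>I. exp (- \<theta> * \<bar>real_of_int (f i)\<bar>)))"
    using G finE by (intro sum_mono2) (auto intro!: mult_nonneg_nonneg prod_nonneg)
  also have "\<dots> = exp (\<theta> * X) * (\<Prod>i\<in>I. \<Sum>v\<in>{- int B..int B}. exp (- \<theta> * \<bar>real_of_int v\<bar>))"
    using assms(3) by (subst prod_sum_PiE) (auto simp: sum_distrib_left)
  also have "\<dots> \<le> exp (\<theta> * X) * (\<Prod>i\<in>I. 4 / \<theta>)"
    using sum_exp_neg_abs_le[OF assms(1,2)]
    by (intro mult_left_mono prod_mono conjI sum_nonneg) auto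
  finally show ?thesis by simp
qed

lemma real_of_nat_div_upper:
  assumes "(s::nat) > 0"
  shows "real x / real s \<le> real (x div s) + 1"
proof -
  have "x \<le> s * (x div s + 1)"
    using assms by (metis Suc_eq_plus1 dividend_less_times_div less_imp_le mult_Suc_right add.commute)
  then have "real x \<le> real s * (real (x div s) + 1)"
    by (metis of_nat_1 of_nat_add of_nat_le_iff of_nat_mult)
  then show ?thesis using assms by (simp add: field_simps)
qed

lemma abs_div_diff_le:
  fixes a b s :: nat
  assumes "s > 0"
  shows "\<bar>real_of_int (int (a div s) - int (b div s))\<bar> \<le> \<bar>real a - real b\<bar> / real s + 1"
proof -
  have "real (x div s) \<le> real x / real s" "real x / real s \<le> real (x div s) + 1" for x
    using of_nat_div_le_of_nat[of x s] real_of_nat_div_upper[OF assms] by blast+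
  note this[of a] this[of b]
  moreover have "\<bar>real a - real b\<bar> / real s = \<bar>real a / real s - real b / real s\<bar>"
    by (simp add: diff_divide_distrib[symmetric] abs_divide)
  ultimately show ?thesis by (simp add: abs_le_iff) linarith
qed

text \<open>A coarsening is determined by the vector of block displacements from
  \<open>\<sigma>\<close>. Its \<open>L1\<close> norm is at most the footrule divided by
  \<open>s\<close>, plus 1 per item for rounding, and the footrule is at most \<open>2 * R\<close>.
  The parameter \<open>\<theta>\<close> is left free to be tuned to the scale.\<close>

lemma card_coarsen_ball_le:
  fixes \<theta> R :: real
  assumes \<theta>: "0 < \<theta>" "\<theta> \<le> 1" and s: "s > 0" and \<sigma>: "\<sigma> permutes {1..n}"
  shows "real (card (coarsen n s ` {\<pi>. \<pi> permutes {1..n} \<and> real (card (discordant n \<pi> \<sigma>)) \<le> R}))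
      \<le> exp (\<theta> * (n + 2 * R / s)) * (4 / \<theta>) ^ n"
proof -
  define Ball where "Ball = {\<pi>. \<pi> permutes {1..n} \<and> real (card (discordant n \<pi> \<sigma>)) \<le> R}"
  define v where "v \<pi> = (\<lambda>i\<in>{1..n}. int (\<pi> i div s) - int (\<sigma> i div s))" for \<pi>
  have finB: "finite Ball"
    unfolding Ball_def by (rule finite_subset[OF _ finite_permutations[of "{1..n}"]]) auto
  \<comment> \<open>\<open>h\<close> reads the coarsening off the displacement vector: any member of
    the ball with that vector has the same block numbers.\<close>
  define h where "h f = coarsen n s (SOME \<pi>. \<pi> \<in> Ball \<and> v \<pi> = f)" for f
  have "coarsen n s \<pi> = h (v \<pi>)" if "\<pi> \<in> Ball" for \<pi>
  proof -
    define \<tau> where "\<tau> = (SOME \<tau>. \<tau> \<in> Ball \<and> v \<tau> = v \<pi>)"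
    have \<tau>: "\<tau> \<in> Ball \<and> v \<tau> = v \<pi>"
      unfolding \<tau>_def by (rule someI[of _ \<pi>]) (use that in auto)
    have "\<pi> i div s = \<tau> i div s" if i: "i \<in> {1..n}" for i
    proof -
      have "v \<tau> i = v \<pi> i" using \<tau> by simp
      then show ?thesis using i by (simp add: v_def)
    qed
    then show ?thesis unfolding h_def \<tau>_def[symmetric] by (rule coarsen_cong)
  qed
  then have "coarsen n s ` Ball \<subseteq> h ` v ` Ball" by auto
  then have "card (coarsen n s ` Ball) \<le> card (v ` Ball)"
    using finB by (meson card_image_le card_mono finite_imageI le_trans)
  moreover have "real (card (v ` Ball)) \<le> exp (\<theta> * (n + 2 * R / s)) * (4 / \<theta>) ^ card {1..n}"
  proof (rule card_bounded_l1_le[OF \<theta>, where B = n])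
    show "v ` Ball \<subseteq> {f \<in> {1..n} \<rightarrow>\<^sub>E {- int n..int n}.
        (\<Sum>i\<in>{1..n}. \<bar>real_of_int (f i)\<bar>) \<le> real n + 2 * R / real s}"
    proof
      fix f assume "f \<in> v ` Ball"
      then obtain \<pi> where \<pi>: "\<pi> permutes {1..n}" "real (card (discordant n \<pi> \<sigma>)) \<le> R" and f: "f = v \<pi>"
        by (auto simp: Ball_def)
      have "\<pi> i div s \<le> n" "\<sigma> i div s \<le> n" if "i \<in> {1..n}" for i
        using permutes_in_image[OF \<pi>(1), of i] permutes_in_image[OF \<sigma>, of i] that
        by (auto intro: order_trans[OF div_le_dividend])
      then have "f \<in> {1..n} \<rightarrow>\<^sub>E {- int n..int n}"
        unfolding f v_def restrict_PiE_iff by (auto simp: minus_le_iff intro: order_trans[of _ 0]) (smt (verit) of_nat_0_le_iff of_nat_mono)+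
      moreover have "(\<Sum>i\<in>{1..n}. \<bar>real_of_int (f i)\<bar>)
          \<le> (\<Sum>i\<in>{1..n}. \<bar>real (\<pi> i) - real (\<sigma> i)\<bar> / real s + 1)"
        unfolding f v_def by (intro sum_mono) (use abs_div_diff_le[OF s] in auto)
      moreover have "\<dots> = real n + real_of_int (footrule n \<pi> \<sigma>) / real s"
        by (simp add: sum.distrib footrule_def sum_divide_distrib)
      moreover have "real_of_int (footrule n \<pi> \<sigma>) \<le> 2 * R"
        using footrule_le_kendall_tau[OF \<pi>(1) \<sigma>] kendall_tau_eq_card_discordant[OF \<pi>(1) \<sigma>] \<pi>(2)
        by linarith
      then have "real n + real_of_int (footrule n \<pi> \<sigma>) / real s \<le> real n + 2 * R / real s"
        by (simp add: divide_right_mono)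
      ultimately show "f \<in> {f \<in> {1..n} \<rightarrow>\<^sub>E {- int n..int n}.
        (\<Sum>i\<in>{1..n}. \<bar>real_of_int (f i)\<bar>) \<le> real n + 2 * R / real s}" by auto
    qed
  qed auto
  ultimately show ?thesis unfolding Ball_def by simp
qed

section \<open>Generating functions of the observations\<close>

abbreviation expect :: "'a pmf \<Rightarrow> ('a \<Rightarrow> real) \<Rightarrow> real" where
  "expect P f \<equiv> measure_pmf.expectation P f"

lemma expect_bind:
  fixes h :: "'b \<Rightarrow> real"
  assumes "finite (set_pmf S)" "\<And>c. finite (set_pmf (f c))"
  shows "expect (bind_pmf S f) h = expect S (\<lambda>c. expect (f c) h)"
proof -
  have "expect (bind_pmf S f) h = (\<Sum>c\<in>set_pmf S. pmf S c *\<^sub>R expect (f c) h)"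
    using assms(1,2) by (intro pmf_expectation_bind) auto
  also have "\<dots> = expect S (\<lambda>c. expect (f c) h)"
    using assms(1) by (subst integral_measure_pmf_real[of "set_pmf S"]) (auto simp: mult.commute)
  finally show ?thesis .
qed

definition margin :: "observation \<Rightarrow> nat \<times> nat \<Rightarrow> real" where
  "margin x q = real (snd x (fst q) (snd q)) - real (snd x (snd q) (fst q))"

lemma margin_observe:
  assumes "q \<in> item_pairs n"
  shows "margin (observe c w) q = (\<Sum>k<c q. if w (q, k) then 1 else - 1)"
proof -
  obtain i j where q: "q = (i, j)" by fastforce
  have ij: "i < j" using assms q by (auto simp: item_pairs_def)
  have "(\<Sum>k<c q. if w (q, k) then 1 else - 1 :: real) =
      real (card ({..<c q} \<inter> {k. w (q, k)})) - real (card ({..<c q} \<inter> - {k. w (q, k)}))"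
    by (subst sum.If_cases) auto
  also have "{..<c q} \<inter> {k. w (q, k)} = {k. k < c q \<and> w (q, k)}" by auto
  also have "{..<c q} \<inter> - {k. w (q, k)} = {k. k < c q \<and> \<not> w (q, k)}" by auto
  finally show ?thesis using ij by (simp add: margin_def observe_def q)
qed

lemma finite_set_pmf_outcomes [simp]: "finite (set_pmf (outcomes n \<pi> M c))"
  unfolding outcomes_def by (subst set_Pi_pmf) (auto intro!: finite_PiE_dflt)

text \<open>General factors \<open>g\<close> let one formula serve both for exponential moments of
  margins and for Hellinger affinities.\<close>

lemma expect_outcomes_prod:
  fixes g :: "nat \<times> nat \<Rightarrow> bool \<Rightarrow> real"
  assumes \<pi>: "\<pi> permutes {1..n}" and M: "M \<in> comparison_matrices n lam"
    and g: "\<And>q b. q \<in> item_pairs n \<Longrightarrow> 0 \<le> g q b"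
  defines "m \<equiv> \<lambda>q. M (\<pi> (fst q)) (\<pi> (snd q))"
  shows "expect (outcomes n \<pi> M c) (\<lambda>w. \<Prod>q\<in>item_pairs n. \<Prod>k<c q. g q (w (q, k))) =
    (\<Prod>q\<in>item_pairs n. (m q * g q True + (1 - m q) * g q False) ^ c q)"
proof -
  let ?I = "SIGMA q : item_pairs n. {..<c q}"
  have m01: "0 \<le> m q" "m q \<le> 1" if "q \<in> item_pairs n" for q
  proof -
    have "fst q \<in> {1..n}" "snd q \<in> {1..n}" using that by (auto simp: item_pairs_def)
    then have "\<pi> (fst q) \<in> {1..n}" "\<pi> (snd q) \<in> {1..n}"
      using permutes_in_image[OF \<pi>] by blast+
    then show "0 \<le> m q" "m q \<le> 1" using M by (auto simp: comparison_matrices_def m_def)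
  qed
  have "expect (outcomes n \<pi> M c) (\<lambda>w. \<Prod>q\<in>item_pairs n. \<Prod>k<c q. g q (w (q, k))) =
    expect (Pi_pmf ?I False (\<lambda>z. bernoulli_pmf (m (fst z)))) (\<lambda>w. \<Prod>z\<in>?I. g (fst z) (w z))"
    unfolding outcomes_def m_def
    by (simp add: prod.Sigma case_prod_unfold)
  also have "\<dots> = (\<Prod>z\<in>?I. expect (bernoulli_pmf (m (fst z))) (g (fst z)))"
    using g by (intro expectation_prod_Pi_pmf integrable_measure_pmf_finite) auto
  also have "\<dots> = (\<Prod>z\<in>?I. m (fst z) * g (fst z) True + (1 - m (fst z)) * g (fst z) False)"
    using m01 by (intro prod.cong) (auto simp: mult.commute)
  also have "\<dots> = (\<Prod>q\<in>item_pairs n. \<Prod>k<c q. m q * g q True + (1 - m q) * g q False)"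
    by (subst prod.Sigma) (auto simp: case_prod_unfold)
  finally show ?thesis by simp
qed

text \<open>What the two sampling models have in common: with \<open>p\<close> the mean number of comparisons
  of a pair, the generating function of the counts is dominated by that of independent Poisson
  variables, and is bounded below by a comparable quantity.\<close>

definition regular_sampling :: "nat \<Rightarrow> real \<Rightarrow> (nat \<times> nat \<Rightarrow> nat) pmf \<Rightarrow> bool" where
  "regular_sampling n p S \<longleftrightarrow> finite (set_pmf S) \<and>
     (\<forall>\<phi>. (\<forall>q\<in>item_pairs n. 0 \<le> \<phi> q) \<longrightarrow>
        expect S (\<lambda>c. \<Prod>q\<in>item_pairs n. \<phi> q ^ c q) \<le> exp (p * (\<Sum>q\<in>item_pairs n. \<phi> q - 1))) \<and>
     (\<forall>D x. D \<subseteq> item_pairs n \<and> 0 \<le> x \<and> x < 1 \<longrightarrow>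
        exp (- (p * x * card D / (1 - x))) \<le>
          expect S (\<lambda>c. \<Prod>q\<in>item_pairs n. (if q \<in> D then 1 - x else 1) ^ c q))"

text \<open>Taking reciprocals reduces this to \<open>1 + u \<le> exp u\<close>. The denominator
  \<open>1 - x\<close> in place of \<open>1 - z\<close> gives both sampling models the same
  bound.\<close>

lemma exp_neg_le_one_minus:
  fixes x z :: real
  assumes "0 \<le> z" "z \<le> x" "x < 1"
  shows "exp (- (z / (1 - x))) \<le> 1 - z"
proof -
  have "1 / (1 - z) = 1 + z / (1 - z)" using assms by (simp add: field_simps)
  also have "\<dots> \<le> exp (z / (1 - z))" by (rule exp_ge_add_one_self)
  also have "\<dots> \<le> exp (z / (1 - x))"
    using assms by (auto intro!: divide_left_mono mult_pos_pos)
  finally have "1 / (1 - z) \<le> exp (z / (1 - x))" .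
  then show ?thesis using assms by (simp add: exp_minus field_simps)
qed

section \<open>Generating functions of the two sampling models\<close>

lemma expect_sampling_O1:
  assumes "0 \<le> p" "p \<le> 1" "\<And>q. q \<in> item_pairs n \<Longrightarrow> 0 \<le> \<phi> q"
  shows "expect (sampling_O1 n p) (\<lambda>c. \<Prod>q\<in>item_pairs n. \<phi> q ^ c q) =
    (\<Prod>q\<in>item_pairs n. 1 + p * (\<phi> q - 1))"
proof -
  have "expect (sampling_O1 n p) (\<lambda>c. \<Prod>q\<in>item_pairs n. \<phi> q ^ c q) =
    (\<Prod>q\<in>item_pairs n. expect (map_pmf of_bool (bernoulli_pmf p)) (\<lambda>k. \<phi> q ^ k))"
    unfolding sampling_O1_def
    using assms(3) by (intro expectation_prod_Pi_pmf integrable_measure_pmf_finite) auto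
  also have "\<dots> = (\<Prod>q\<in>item_pairs n. 1 + p * (\<phi> q - 1))"
    using assms(1,2) by (intro prod.cong) (auto simp: algebra_simps)
  finally show ?thesis .
qed

lemma regular_sampling_O1:
  assumes "0 < p" "p \<le> 1"
  shows "regular_sampling n p (sampling_O1 n p)"
  unfolding regular_sampling_def
proof (intro conjI allI impI finite_set_pmf_sampling_O1; (elim conjE)?)
  fix \<phi> :: "nat \<times> nat \<Rightarrow> real" assume \<phi>: "\<forall>q\<in>item_pairs n. 0 \<le> \<phi> q"
  have "(\<Prod>q\<in>item_pairs n. 1 + p * (\<phi> q - 1)) \<le> (\<Prod>q\<in>item_pairs n. exp (p * (\<phi> q - 1)))"
  proof (intro prod_mono conjI exp_ge_add_one_self)
    fix q assume "q \<in> item_pairs n"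
    then have "0 \<le> p * \<phi> q" using \<phi> assms by simp
    then show "0 \<le> 1 + p * (\<phi> q - 1)" using assms by (simp add: right_diff_distrib)
  qed
  then show "expect (sampling_O1 n p) (\<lambda>c. \<Prod>q\<in>item_pairs n. \<phi> q ^ c q)
      \<le> exp (p * (\<Sum>q\<in>item_pairs n. \<phi> q - 1))"
    using assms \<phi> by (simp add: expect_sampling_O1 exp_sum sum_distrib_left)
next
  fix D and x :: real assume D: "D \<subseteq> item_pairs n" and x: "0 \<le> x" "x < 1"
  have "p * x \<le> x" using assms x by (simp add: mult_left_le_one_le)
  then have e: "exp (- (p * x / (1 - x))) \<le> 1 - p * x"
    using assms x by (intro exp_neg_le_one_minus) auto
  have "exp (- (p * x * card D / (1 - x))) = exp (- (p * x / (1 - x))) ^ card D"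
    by (simp add: exp_of_nat_mult[symmetric])
  also have "\<dots> \<le> (1 - p * x) ^ card D" using e by (intro power_mono) auto
  also have "\<dots> = (\<Prod>q\<in>item_pairs n. if q \<in> D then 1 - p * x else 1)"
    using D by (subst prod.If_cases) (auto simp: Int_absorb1 inf.absorb2)
  also have "\<dots> = (\<Prod>q\<in>item_pairs n. 1 + p * ((if q \<in> D then 1 - x else 1) - 1))"
    by (intro prod.cong) auto
  also have "\<dots> = expect (sampling_O1 n p)
      (\<lambda>c. \<Prod>q\<in>item_pairs n. (if q \<in> D then 1 - x else 1) ^ c q)"
    using assms x by (intro expect_sampling_O1[symmetric]) auto
  finally show "exp (- (p * x * card D / (1 - x))) \<le> \<dots>" .
qed

lemma card_item_pairs: "card (item_pairs n) = n choose 2"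
proof -
  have "bij_betw (\<lambda>(i, j). {i, j}) (item_pairs n) {K \<in> Pow {1..n}. card K = 2}"
    unfolding bij_betw_def
  proof
    show "inj_on (\<lambda>(i, j). {i, j}) (item_pairs n)"
      by (auto simp: inj_on_def item_pairs_def doubleton_eq_iff)
    show "(\<lambda>(i, j). {i, j}) ` item_pairs n = {K \<in> Pow {1..n}. card K = 2}"
    proof (intro equalityI subsetI)
      fix K assume "K \<in> {K \<in> Pow {1..n}. card K = 2}"
      then obtain i j where K: "K = {i, j}" "i \<noteq> j" "i \<in> {1..n}" "j \<in> {1..n}"
        by (auto simp: card_2_iff)
      have "(min i j, max i j) \<in> item_pairs n"
        using K by (auto simp: item_pairs_def min_def max_def)
      moreover have "(\<lambda>(i, j). {i, j}) (min i j, max i j) = K"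
        using K by (auto simp: min_def max_def)
      ultimately show "K \<in> (\<lambda>(i, j). {i, j}) ` item_pairs n" by (metis image_eqI)
    qed (auto simp: item_pairs_def card_2_iff)
  qed
  then show ?thesis by (simp add: bij_betw_same_card n_subsets)
qed

text \<open>The counts are multinomial, hence dependent, but the product over pairs regroups into a
  product over the \<open>N\<close> independent draws.\<close>

lemma expect_sampling_O2:
  assumes "n \<ge> 2" "\<And>q. q \<in> item_pairs n \<Longrightarrow> 0 \<le> \<phi> q"
  shows "expect (sampling_O2 n N) (\<lambda>c. \<Prod>q\<in>item_pairs n. \<phi> q ^ c q) =
    (1 + (\<Sum>q\<in>item_pairs n. \<phi> q - 1) / (n choose 2)) ^ N"
proof -
  have "(1, 2) \<in> item_pairs n" using assms by (auto simp: item_pairs_def)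
  then have ne: "item_pairs n \<noteq> {}" by blast
  then have pos: "0 < card (item_pairs n)" by (simp add: card_gt_0_iff)
  let ?Q = "Pi_pmf {..<N} (0, 0) (\<lambda>_. pmf_of_set (item_pairs n))"
  have "expect (sampling_O2 n N) (\<lambda>c. \<Prod>q\<in>item_pairs n. \<phi> q ^ c q) =
      expect ?Q (\<lambda>s. \<Prod>q\<in>item_pairs n. \<phi> q ^ card {t. t < N \<and> s t = q})"
    unfolding sampling_O2_def by simp
  also have "\<dots> = expect ?Q (\<lambda>s. \<Prod>t\<in>{..<N}. \<phi> (s t))"
  proof (rule integral_cong_AE)
    have "(\<Prod>q\<in>item_pairs n. \<phi> q ^ card {t. t < N \<and> s t = q}) = (\<Prod>t\<in>{..<N}. \<phi> (s t))"
      if "s \<in> set_pmf ?Q" for s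
    proof -
      have im: "s ` {..<N} \<subseteq> item_pairs n"
        using that ne by (auto simp: set_Pi_pmf PiE_dflt_def)
      have "(\<Prod>t\<in>{..<N}. \<phi> (s t)) = (\<Prod>q\<in>item_pairs n. \<Prod>t\<in>{t \<in> {..<N}. s t = q}. \<phi> (s t))"
        using im by (intro prod.group[symmetric]) auto
      also have "\<dots> = (\<Prod>q\<in>item_pairs n. \<phi> q ^ card {t. t < N \<and> s t = q})"
        by (intro prod.cong) auto
      finally show ?thesis ..
    qed
    then show "AE s in ?Q. (\<Prod>q\<in>item_pairs n. \<phi> q ^ card {t. t < N \<and> s t = q}) = (\<Prod>t\<in>{..<N}. \<phi> (s t))"
      by (auto simp: AE_measure_pmf_iff)
  qed auto
  also have "\<dots> = (\<Prod>t\<in>{..<N}. expect (pmf_of_set (item_pairs n)) \<phi>)"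
    using assms(2) ne by (intro expectation_prod_Pi_pmf integrable_measure_pmf_finite) auto
  also have "\<dots> = ((\<Sum>q\<in>item_pairs n. \<phi> q) / card (item_pairs n)) ^ N"
    using ne by (simp add: integral_pmf_of_set)
  also have "(\<Sum>q\<in>item_pairs n. \<phi> q) / card (item_pairs n) =
      1 + (\<Sum>q\<in>item_pairs n. \<phi> q - 1) / card (item_pairs n)"
    using ne by (simp add: sum_subtractf diff_divide_distrib)
  finally show ?thesis by (simp add: card_item_pairs)
qed

lemma regular_sampling_O2:
  assumes "n \<ge> 2"
  shows "regular_sampling n (N / (n choose 2)) (sampling_O2 n N)"
  unfolding regular_sampling_def
proof (intro conjI allI impI finite_set_pmf_sampling_O2 assms; (elim conjE)?)
  have pos: "0 < real (n choose 2)" using assms by simp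
  {
    fix \<phi> :: "nat \<times> nat \<Rightarrow> real" assume \<phi>: "\<forall>q\<in>item_pairs n. 0 \<le> \<phi> q"
    let ?s = "\<Sum>q\<in>item_pairs n. \<phi> q - 1"
    have "0 \<le> (\<Sum>q\<in>item_pairs n. \<phi> q) / (n choose 2)" using \<phi> by (simp add: sum_nonneg)
    then have "0 \<le> 1 + ?s / (n choose 2)"
      using pos by (simp add: sum_subtractf card_item_pairs diff_divide_distrib)
    then have "(1 + ?s / (n choose 2)) ^ N \<le> exp (?s / (n choose 2)) ^ N"
      by (intro power_mono exp_ge_add_one_self)
    also have "\<dots> = exp (N / (n choose 2) * ?s)" by (simp add: exp_of_nat_mult[symmetric])
    finally show "expect (sampling_O2 n N) (\<lambda>c. \<Prod>q\<in>item_pairs n. \<phi> q ^ c q)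
        \<le> exp (N / (n choose 2) * ?s)"
      using assms \<phi> by (simp add: expect_sampling_O2)
  next
    fix D and x :: real assume D: "D \<subseteq> item_pairs n" and x: "0 \<le> x" "x < 1"
    have "card D \<le> n choose 2"
      using card_mono[OF _ D] by (simp add: card_item_pairs)
    then have "x * (card D / (n choose 2)) \<le> x * 1" using x pos by (intro mult_left_mono) auto
    then have e: "exp (- (x * card D / (n choose 2) / (1 - x))) \<le> 1 - x * card D / (n choose 2)"
      using x by (intro exp_neg_le_one_minus) auto
    have "exp (- (N / (n choose 2) * x * card D / (1 - x)))
        = exp (- (x * card D / (n choose 2) / (1 - x))) ^ N"
      by (simp add: exp_of_nat_mult[symmetric])
    also have "\<dots> \<le> (1 - x * card D / (n choose 2)) ^ N" using e by (intro power_mono) auto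
    also have "x * card D = - (\<Sum>q\<in>item_pairs n. (if q \<in> D then 1 - x else 1) - 1)"
    proof -
      have "(\<Sum>q\<in>item_pairs n. (if q \<in> D then 1 - x else 1) - 1) = (\<Sum>q\<in>item_pairs n. if q \<in> D then - x else 0)"
        by (intro sum.cong) auto
      also have "\<dots> = - (x * card D)"
        using D by (subst sum.If_cases) (auto simp: inf.absorb2)
      finally show ?thesis by simp
    qed
    also have "(1 - - (\<Sum>q\<in>item_pairs n. (if q \<in> D then 1 - x else 1) - 1) / (n choose 2)) ^ N =
      expect (sampling_O2 n N) (\<lambda>c. \<Prod>q\<in>item_pairs n. (if q \<in> D then 1 - x else 1) ^ c q)"
      using assms x by (subst expect_sampling_O2) auto
    finally show "exp (- (N / (n choose 2) * x * card D / (1 - x))) \<le> \<dots>" .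
  }
qed

section \<open>Exponential moments of the margins\<close>

lemma exp_le_quadratic:
  fixes x :: real
  assumes "\<bar>x\<bar> \<le> 1"
  shows "exp x \<le> 1 + x + x\<^sup>2"
proof (cases "0 \<le> x")
  case True
  then show ?thesis using assms by (intro exp_bound) auto
next
  case False
  define y where "y = - x"
  have y: "0 < y" using False by (simp add: y_def)
  have "1 + y + y\<^sup>2 / 2 \<le> exp y" using y by (intro exp_lower_Taylor_quadratic) auto
  then have "1 \<le> (1 - y + y\<^sup>2) * exp y"
  proof -
    have "0 \<le> 1 - y + y\<^sup>2"
      using sum_power2_ge_zero[of "y - 1/2" 0] by (simp add: power2_eq_square algebra_simps)
    then have "(1 - y + y\<^sup>2) * (1 + y + y\<^sup>2 / 2) \<le> (1 - y + y\<^sup>2) * exp y"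
      using \<open>1 + y + y\<^sup>2 / 2 \<le> exp y\<close> by (intro mult_left_mono) auto
    moreover have "(1 - y + y\<^sup>2) * (1 + y + y\<^sup>2 / 2) = 1 + (y ^ 2 + y ^ 3 + y ^ 4) / 2"
      by (simp add: power2_eq_square power3_eq_cube power4_eq_xxxx field_simps)
    moreover have "0 \<le> y ^ 2 + y ^ 3 + y ^ 4" using y by simp
    ultimately have "1 + (y ^ 2 + y ^ 3 + y ^ 4) / 2 \<le> (1 - y + y\<^sup>2) * exp y"
      "1 \<le> 1 + (y ^ 2 + y ^ 3 + y ^ 4) / 2" by simp_all
    then show ?thesis by (rule order_trans[rotated])
  qed
  then have "exp (- y) \<le> 1 - y + y\<^sup>2" by (simp add: exp_minus field_simps)
  then show ?thesis by (simp add: y_def)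
qed

lemma finite_set_pmf_observation_law:
  assumes "finite (set_pmf S)"
  shows "finite (set_pmf (observation_law n S \<pi> M))"
  unfolding observation_law_def using assms by simp

lemma expect_observation_law:
  assumes "finite (set_pmf S)"
  shows "expect (observation_law n S \<pi> M) h =
    expect S (\<lambda>c. expect (outcomes n \<pi> M c) (\<lambda>w. h (observe c w)))"
  unfolding observation_law_def using assms by (subst expect_bind) auto

text \<open>Given the counts, margins are sums of independent signs, which yields a factor
  \<open>\<phi> q\<close> per comparison. Poisson domination turns the product into an exponential
  of the sum of \<open>\<phi> q - 1\<close>, whose linear part in \<open>t\<close> is exactly the
  centring. The randomness of the counts is thus included, and the variance proxy is
  \<open>p\<close> times the size of the support of \<open>w\<close>.\<close>

lemma margin_mgf:
  fixes w :: "nat \<times> nat \<Rightarrow> real"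
  assumes S: "regular_sampling n p S" and p: "0 < p"
    and \<pi>: "\<pi> permutes {1..n}" and M: "M \<in> comparison_matrices n lam"
    and w: "\<And>q. q \<in> item_pairs n \<Longrightarrow> w q \<in> {-1, 0, 1}" and t: "\<bar>t\<bar> \<le> 1"
  defines "m \<equiv> \<lambda>q. 2 * M (\<pi> (fst q)) (\<pi> (snd q)) - 1"
  shows "expect (observation_law n S \<pi> M)
      (\<lambda>x. exp (t * (\<Sum>q\<in>item_pairs n. w q * (margin x q - p * m q))))
    \<le> exp (t\<^sup>2 * p * card {q \<in> item_pairs n. w q \<noteq> 0})"
proof -
  define Mq where "Mq q = M (\<pi> (fst q)) (\<pi> (snd q))" for q
  define \<phi> where "\<phi> q = Mq q * exp (t * w q) + (1 - Mq q) * exp (- (t * w q))" for q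
  have finS: "finite (set_pmf S)" using S by (simp add: regular_sampling_def)
  have Mq01: "0 \<le> Mq q" "Mq q \<le> 1" if "q \<in> item_pairs n" for q
  proof -
    have "fst q \<in> {1..n}" "snd q \<in> {1..n}" using that by (auto simp: item_pairs_def)
    then have "\<pi> (fst q) \<in> {1..n}" "\<pi> (snd q) \<in> {1..n}"
      using permutes_in_image[OF \<pi>] by blast+
    then show "0 \<le> Mq q" "Mq q \<le> 1" using M by (auto simp: comparison_matrices_def Mq_def)
  qed
  define Cc where "Cc = exp (- (t * p * (\<Sum>q\<in>item_pairs n. w q * m q)))"
  have inner: "expect (outcomes n \<pi> M c) (\<lambda>v. exp (t * (\<Sum>q\<in>item_pairs n. w q * (margin (observe c v) q - p * m q))))
      = Cc * (\<Prod>q\<in>item_pairs n. \<phi> q ^ c q)" for c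
  proof -
    have "exp (t * (\<Sum>q\<in>item_pairs n. w q * (margin (observe c v) q - p * m q))) =
      Cc * (\<Prod>q\<in>item_pairs n. \<Prod>k<c q. exp (t * w q * (if v (q, k) then 1 else - 1)))" for v
    proof -
      have "t * (\<Sum>q\<in>item_pairs n. w q * (margin (observe c v) q - p * m q)) =
        - (t * p * (\<Sum>q\<in>item_pairs n. w q * m q)) + (\<Sum>q\<in>item_pairs n. t * w q * margin (observe c v) q)"
        by (simp add: right_diff_distrib sum_subtractf sum_distrib_left algebra_simps)
      also have "(\<Sum>q\<in>item_pairs n. t * w q * margin (observe c v) q) =
          (\<Sum>q\<in>item_pairs n. \<Sum>k<c q. t * w q * (if v (q, k) then 1 else - 1))"
        by (intro sum.cong) (simp_all add: margin_observe sum_distrib_left)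
      finally show ?thesis by (simp only: exp_add Cc_def exp_sum finite_item_pairs finite_lessThan)
    qed
    then have "expect (outcomes n \<pi> M c) (\<lambda>v. exp (t * (\<Sum>q\<in>item_pairs n. w q * (margin (observe c v) q - p * m q))))
      = Cc * expect (outcomes n \<pi> M c) (\<lambda>v. \<Prod>q\<in>item_pairs n. \<Prod>k<c q. exp (t * w q * (if v (q, k) then 1 else - 1)))"
      by simp
    also have "\<dots> = Cc * (\<Prod>q\<in>item_pairs n. \<phi> q ^ c q)"
      by (subst expect_outcomes_prod[OF \<pi> M]) (auto simp: \<phi>_def Mq_def)
    finally show ?thesis .
  qed
  have \<phi>: "\<phi> q - 1 \<le> t * (w q * m q) + t\<^sup>2 * of_bool (w q \<noteq> 0)" if q: "q \<in> item_pairs n" for q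
  proof -
    have "\<bar>t * w q\<bar> \<le> 1" using w[OF q] t by auto
    then have "exp (t * w q) \<le> 1 + t * w q + (t * w q)\<^sup>2"
      "exp (- (t * w q)) \<le> 1 - t * w q + (t * w q)\<^sup>2"
      using exp_le_quadratic[of "t * w q"] exp_le_quadratic[of "- (t * w q)"] by auto
    then have "\<phi> q \<le> Mq q * (1 + t * w q + (t * w q)\<^sup>2) + (1 - Mq q) * (1 - t * w q + (t * w q)\<^sup>2)"
      unfolding \<phi>_def using Mq01[OF q] by (intro add_mono mult_left_mono) auto
    also have "\<dots> = 1 + t * (w q * m q) + (t * w q)\<^sup>2"
      by (simp add: m_def Mq_def algebra_simps)
    also have "(t * w q)\<^sup>2 = t\<^sup>2 * of_bool (w q \<noteq> 0)" using w[OF q] by (auto simp: power_mult_distrib)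
    finally show ?thesis by simp
  qed
  have "expect (observation_law n S \<pi> M)
      (\<lambda>x. exp (t * (\<Sum>q\<in>item_pairs n. w q * (margin x q - p * m q))))
    = Cc * expect S (\<lambda>c. \<Prod>q\<in>item_pairs n. \<phi> q ^ c q)"
    using finS by (simp add: expect_observation_law inner)
  also have "\<dots> \<le> Cc * exp (p * (\<Sum>q\<in>item_pairs n. \<phi> q - 1))"
    using S Mq01 unfolding regular_sampling_def
    by (intro mult_left_mono) (auto simp: Cc_def \<phi>_def)
  also have "\<dots> \<le> Cc * exp (p * (\<Sum>q\<in>item_pairs n. t * (w q * m q) + t\<^sup>2 * of_bool (w q \<noteq> 0)))"
    using p \<phi> by (intro mult_left_mono) (auto simp: Cc_def intro!: mult_left_mono sum_mono)
  also have "(\<Sum>q\<in>item_pairs n. t * (w q * m q) + t\<^sup>2 * of_bool (w q \<noteq> 0)) =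
      t * (\<Sum>q\<in>item_pairs n. w q * m q) + t\<^sup>2 * card {q \<in> item_pairs n. w q \<noteq> 0}"
    by (simp add: sum.distrib sum_distrib_left[symmetric] Collect_conj_eq)
  also have "Cc * exp (p * (t * (\<Sum>q\<in>item_pairs n. w q * m q) + t\<^sup>2 * card {q \<in> item_pairs n. w q \<noteq> 0}))
      = exp (t\<^sup>2 * p * card {q \<in> item_pairs n. w q \<noteq> 0})"
    unfolding Cc_def by (simp add: exp_add[symmetric] algebra_simps)
  finally show ?thesis .
qed

section \<open>Chaining\<close>

text \<open>Items of larger rank win more often, so \<open>1\<close> predicts that the first item of
  the pair beats the second.\<close>

definition order_sign :: "(nat \<Rightarrow> nat) \<Rightarrow> nat \<times> nat \<Rightarrow> real" where
  "order_sign \<pi> q = (if ranks_above \<pi> q then 1 else - 1)"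

text \<open>Agreeing minus disagreeing comparisons, that is, twice the agreements minus a number
  independent of \<open>\<pi>\<close>.\<close>

definition score :: "nat \<Rightarrow> (nat \<Rightarrow> nat) \<Rightarrow> observation \<Rightarrow> real" where
  "score n \<pi> x = (\<Sum>q\<in>item_pairs n. order_sign \<pi> q * margin x q)"

definition sieve :: "nat \<Rightarrow> nat \<Rightarrow> (nat \<Rightarrow> nat) set" where
  "sieve n m = coarsen n m ` {\<pi>. \<pi> permutes {1..n}}"

lemma sieve_permutes: "\<pi> \<in> sieve n m \<Longrightarrow> \<pi> permutes {1..n}"
  unfolding sieve_def using coarsen_permutes by blast

lemma coarsen_sieve:
  assumes "\<pi> \<in> sieve n m"
  shows "coarsen n m \<pi> = \<pi>"
  using assms coarsen_coarsen[of _ n m 1] by (auto simp: sieve_def)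

lemma sum_geometric_half: "(\<Sum>l\<le>K. (1/2) ^ Suc l) = 1 - (1/2 :: real) ^ Suc K"
  by (induction K) (auto simp: field_simps)

text \<open>Adds up the thresholds of the chaining levels: for \<open>b = 22 + a\<close> the limit
  \<open>2 * b + 6\<close> is the \<open>50 + 2 * a\<close> of the noise bound.\<close>

lemma sum_linear_geometric_half:
  "(\<Sum>l\<le>K. (b + 3 * real l) / 2 ^ l) = 2 * b + 6 - (b + 3 * real K + 6) / 2 ^ K"
  by (induction K) (auto simp: field_simps)

text \<open>Here \<open>3364 = 58\<^sup>2\<close>. It allows the deviation level
  \<open>2 * j\<close> on the \<open>j\<close>-th shell, whose radius has doubled \<open>j\<close>
  times.\<close>

lemma quadratic_le_exponential: "(58 + 6 * real j)\<^sup>2 \<le> 3364 * 2 ^ j"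
proof (induction j)
  case (Suc j)
  have "(58 + 6 * real (Suc j))\<^sup>2 \<le> 2 * (58 + 6 * real j)\<^sup>2"
    by (simp add: power2_eq_square algebra_simps)
  then show ?case using Suc by simp
qed simp

lemma ex_power4_bracket:
  fixes y :: real
  assumes "0 < m" "m \<le> y"
  shows "\<exists>K. m * 4 ^ K \<le> y \<and> y < m * 4 ^ Suc K"
proof -
  obtain k where k: "y / m < 4 ^ k" using real_arch_pow[of 4 "y / m"] by auto
  define K where "K = (LEAST k. y / m < 4 ^ k)"
  have K: "y / m < 4 ^ K" unfolding K_def by (rule LeastI[of "\<lambda>k. y / m < 4 ^ k", OF k])
  have "1 \<le> y / m" using assms by simp
  then have "K \<noteq> 0" using K by (cases "K = 0") auto
  then obtain K' where K': "K = Suc K'" by (cases K) auto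
  have "\<not> y / m < 4 ^ K'"
    unfolding K_def using not_less_Least[of K' "\<lambda>k. y / m < 4 ^ k"] K' K_def by auto
  then show ?thesis
    using K K' assms by (intro exI[of _ K']) (auto simp: field_simps)
qed

locale noisy_sorting =
  fixes n :: nat and p lam :: real and S :: "(nat \<times> nat \<Rightarrow> nat) pmf"
    and ps :: "nat \<Rightarrow> nat" and M :: "nat \<Rightarrow> nat \<Rightarrow> real"
  assumes n: "1 \<le> n" and p: "0 < p" "p \<le> 1" and lam: "0 < lam" "lam < 1/2"
    and S: "regular_sampling n p S"
    and ps: "ps permutes {1..n}" and M: "M \<in> comparison_matrices n lam"
begin

definition obs :: "observation pmf" where "obs = observation_law n S ps M"

definition mean :: "nat \<times> nat \<Rightarrow> real" where
  "mean q = 2 * M (ps (fst q)) (ps (snd q)) - 1"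

definition weight :: "(nat \<Rightarrow> nat) \<Rightarrow> (nat \<Rightarrow> nat) \<Rightarrow> nat \<times> nat \<Rightarrow> real" where
  "weight \<pi> \<sigma> q = (order_sign \<pi> q - order_sign \<sigma> q) / 2"

text \<open>The centred half-difference of two scores; halving makes the weights \<open>-1\<close>,
  \<open>0\<close> or \<open>1\<close>.\<close>

definition noise :: "(nat \<Rightarrow> nat) \<Rightarrow> (nat \<Rightarrow> nat) \<Rightarrow> observation \<Rightarrow> real" where
  "noise \<pi> \<sigma> x = (\<Sum>q\<in>item_pairs n. weight \<pi> \<sigma> q * (margin x q - p * mean q))"

abbreviation dist :: "(nat \<Rightarrow> nat) \<Rightarrow> (nat \<Rightarrow> nat) \<Rightarrow> nat" where
  "dist \<pi> \<sigma> \<equiv> card (discordant n \<pi> \<sigma>)"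

lemma noise_refl: "noise \<pi> \<pi> x = 0"
  by (simp add: noise_def weight_def)

lemma noise_trans: "noise \<pi> \<tau> x = noise \<pi> \<sigma> x + noise \<sigma> \<tau> x"
  unfolding noise_def weight_def sum.distrib[symmetric]
  by (intro sum.cong refl) (simp add: field_simps)

lemma weight_values: "weight \<pi> \<sigma> q \<in> {-1, 0, 1}"
  by (auto simp: weight_def order_sign_def)

lemma weight_support: "{q \<in> item_pairs n. weight \<pi> \<sigma> q \<noteq> 0} = discordant n \<pi> \<sigma>"
  by (auto simp: weight_def order_sign_def discordant_def split: if_splits)

lemma score_diff:
  "(score n \<pi> x - score n \<sigma> x) / 2 = noise \<pi> \<sigma> x + p * (\<Sum>q\<in>item_pairs n. weight \<pi> \<sigma> q * mean q)"
  unfolding score_def noise_def weight_def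
  by (simp add: sum_subtractf[symmetric] sum_divide_distrib sum_distrib_left sum.distrib[symmetric])
    (intro sum.cong refl, simp add: field_simps)

lemma mean_bounds:
  assumes "q \<in> item_pairs n"
  shows "\<bar>mean q\<bar> \<le> 1" "ranks_above ps q \<Longrightarrow> 2 * lam \<le> mean q"
    "\<not> ranks_above ps q \<Longrightarrow> mean q \<le> - (2 * lam)"
proof -
  let ?i = "ps (fst q)" and ?j = "ps (snd q)"
  have "fst q \<in> {1..n}" "snd q \<in> {1..n}" "fst q \<noteq> snd q" using assms by (auto simp: item_pairs_def)
  then have ij: "?i \<in> {1..n}" "?j \<in> {1..n}" "?i \<noteq> ?j"
    using permutes_in_image[OF ps] permutes_inj[OF ps] by (blast, blast, metis injD)
  then have *: "0 \<le> M ?i ?j" "M ?i ?j \<le> 1" "?j < ?i \<Longrightarrow> 1/2 + lam \<le> M ?i ?j"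
    "?i < ?j \<Longrightarrow> M ?i ?j \<le> 1/2 - lam"
    using M unfolding comparison_matrices_def by blast+
  show "\<bar>mean q\<bar> \<le> 1" using *(1,2) by (auto simp: mean_def)
  show "2 * lam \<le> mean q" if "ranks_above ps q"
    using *(3) that by (simp add: mean_def ranks_above_def)
  show "mean q \<le> - (2 * lam)" if "\<not> ranks_above ps q"
    using *(4) that ij(3) by (simp add: mean_def ranks_above_def)
qed

text \<open>On a discordant pair the weight has the sign opposite to \<open>mean q\<close>, so each
  such pair costs between \<open>2 * lam\<close> and 1. The first bound penalises distant estimates,
  the second limits the bias of the sieve.\<close>

lemma drift_bounds:
  shows "(\<Sum>q\<in>item_pairs n. weight \<pi> ps q * mean q) \<le> - (2 * lam * dist \<pi> ps)"
    and "- real (dist \<pi> ps) \<le> (\<Sum>q\<in>item_pairs n. weight \<pi> ps q * mean q)"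
proof -
  have eq: "(\<Sum>q\<in>item_pairs n. weight \<pi> ps q * mean q) =
      (\<Sum>q\<in>discordant n \<pi> ps. weight \<pi> ps q * mean q)"
    using weight_support[of \<pi> ps] by (intro sum.mono_neutral_right) auto
  have *: "weight \<pi> ps q * mean q \<le> - (2 * lam)" "-1 \<le> weight \<pi> ps q * mean q"
    if "q \<in> discordant n \<pi> ps" for q
  proof -
    have q: "q \<in> item_pairs n" "ranks_above \<pi> q \<noteq> ranks_above ps q"
      using that by (auto simp: discordant_def)
    have "weight \<pi> ps q * mean q \<le> - (2 * lam) \<and> -1 \<le> weight \<pi> ps q * mean q"
      using mean_bounds[OF q(1)] q(2)
      by (cases "ranks_above ps q") (auto simp: weight_def order_sign_def)
    then show "weight \<pi> ps q * mean q \<le> - (2 * lam)" "-1 \<le> weight \<pi> ps q * mean q" by auto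
  qed
  have "(\<Sum>q\<in>discordant n \<pi> ps. weight \<pi> ps q * mean q) \<le> (\<Sum>q\<in>discordant n \<pi> ps. - (2 * lam))"
    by (intro sum_mono *)
  then show "(\<Sum>q\<in>item_pairs n. weight \<pi> ps q * mean q) \<le> - (2 * lam * dist \<pi> ps)"
    unfolding eq by (simp add: mult.commute)
  have "(\<Sum>q\<in>discordant n \<pi> ps. -1) \<le> (\<Sum>q\<in>discordant n \<pi> ps. weight \<pi> ps q * mean q)"
    by (intro sum_mono *)
  then show "- real (dist \<pi> ps) \<le> (\<Sum>q\<in>item_pairs n. weight \<pi> ps q * mean q)"
    unfolding eq by simp
qed

lemma finite_obs [simp]: "finite (set_pmf obs)"
  using S by (simp add: obs_def finite_set_pmf_observation_law regular_sampling_def)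

text \<open>Chernoff's bound, with \<open>t\<close> left free because each chaining level uses its
  own value.\<close>

lemma noise_tail:
  assumes "0 < t" "t \<le> 1"
  shows "measure_pmf.prob obs {x. u \<le> noise \<pi> \<sigma> x} \<le> exp (- (t * u) + t\<^sup>2 * p * dist \<pi> \<sigma>)"
proof -
  have "measure_pmf.prob obs {x. u \<le> noise \<pi> \<sigma> x} =
      measure_pmf.prob obs {x \<in> space obs. exp (t * u) \<le> exp (t * noise \<pi> \<sigma> x)}"
    using assms by simp
  also have "\<dots> \<le> expect obs (\<lambda>x. exp (t * noise \<pi> \<sigma> x)) / exp (t * u)"
    by (rule integral_Markov_inequality_measure[where A = "{}"])
      (auto intro: integrable_measure_pmf_finite)
  also have "\<dots> \<le> exp (t\<^sup>2 * p * dist \<pi> \<sigma>) / exp (t * u)"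
    using margin_mgf[OF S p(1) ps M, of "weight \<pi> \<sigma>" t] weight_values[of \<pi> \<sigma>] assms
    unfolding obs_def noise_def mean_def weight_support[of \<pi> \<sigma>]
    by (intro divide_right_mono) auto
  also have "\<dots> = exp (- (t * u) + t\<^sup>2 * p * dist \<pi> \<sigma>)"
    by (simp only: exp_add exp_minus divide_inverse mult.commute)
  finally show ?thesis .
qed

text \<open>Chaining from \<open>ps\<close> through ever finer coarsenings of \<open>\<pi>\<close>. Level \<open>l\<close> has blocks of
  length \<open>m 4^(K - l)\<close> and at most \<open>exp (n (11 + 2 l))\<close> links; the exponential parameter \<open>t\<close>
  at level \<open>l\<close> is \<open>2^l / \<surd>Y\<close>, which is at most \<open>1\<close> because the finest blocks have
  length \<open>m \<ge> 1 / p\<close>.\<close>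

lemma noise_supremum_tail:
  fixes a R :: real and m K :: nat
  assumes a: "0 \<le> a" and m: "1 \<le> p * m" and R: "R \<le> 4 * n * (m * 4 ^ K)"
  defines "Y \<equiv> p * (m * 4 ^ K)"
  shows "measure_pmf.prob obs {x. \<exists>\<pi>\<in>sieve n m. real (dist \<pi> ps) \<le> R \<and>
      n * sqrt Y * (50 + 2 * a) \<le> noise \<pi> ps x} \<le> exp (- a)"
proof -
  define s where "s l = m * 4 ^ (K - l)" for l
  define Ball where "Ball = {\<pi>. \<pi> permutes {1..n} \<and> real (dist \<pi> ps) \<le> R}"
  \<comment> \<open>A link depends on its finer end alone, so the union bound at a level runs over
    points, not over pairs of points.\<close>
  define next_link where "next_link l \<tau> = (if l = 0 then ps else coarsen n (s (l - 1)) \<tau>)" for l \<tau>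
  \<comment> \<open>After multiplication by \<open>t\<close>, the 22 pays 11 for the number of
    links, 10 for the variance term and 1 for summability; of \<open>3 * l\<close>,
    \<open>2 * l\<close> pays for the number of links and \<open>l\<close> for summability.\<close>
  define u where "u l = n * sqrt Y * ((22 + a + 3 * real l) / 2 ^ l)" for l :: nat
  define bad where "bad l = (\<Union>\<tau>\<in>coarsen n (s l) ` Ball. {x. u l \<le> noise \<tau> (next_link l \<tau>) x})" for l
  have m0: "m > 0" using m p by (cases "m = 0") auto
  have s0: "s l > 0" for l using m0 by (simp add: s_def)
  have Ylow: "4 ^ K \<le> Y"
  proof -
    have "1 * 4 ^ K \<le> p * m * 4 ^ K" using m by (intro mult_right_mono) auto
    then show ?thesis by (simp add: Y_def mult.assoc)
  qed
  then have Ypos: "0 < Y" by (smt (verit) zero_less_power)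
  have finB: "finite Ball"
    unfolding Ball_def by (rule finite_subset[OF _ finite_permutations[of "{1..n}"]]) auto
  have step: "s (l - 1) = s l * 4" if "0 < l" "l \<le> K" for l
  proof -
    have "K - (l - 1) = Suc (K - l)" using that by simp
    then show ?thesis by (simp add: s_def)
  qed
  have chain: "(\<Sum>l\<le>L. noise (coarsen n (s l) \<pi>) (next_link l (coarsen n (s l) \<pi>)) x)
      = noise (coarsen n (s L) \<pi>) ps x" if "\<pi> permutes {1..n}" "L \<le> K" for \<pi> x L
    using that(2)
  proof (induction L)
    case 0
    then show ?case by (simp add: next_link_def)
  next
    case (Suc L)
    have "coarsen n (s L) (coarsen n (s (Suc L)) \<pi>) = coarsen n (s L) \<pi>"
      using step[of "Suc L"] Suc.prems coarsen_coarsen[OF that(1), of "s (Suc L)" 4] by simp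
    then show ?case
      using Suc noise_trans[of "coarsen n (s (Suc L)) \<pi>" ps x "coarsen n (s L) \<pi>"]
      by (simp add: next_link_def)
  qed
  \<comment> \<open>At level 0 the length is at most
    \<open>2 * n * s 0 + R \<le> 6 * n * s 0\<close>; at later levels it is at most
    \<open>2 * n * s (l - 1) = 8 * n * s l\<close>.\<close>
  have link: "real (dist \<tau> (next_link l \<tau>)) \<le> 10 * n * s l"
    if \<tau>: "\<tau> \<in> coarsen n (s l) ` Ball" and l: "l \<le> K" for l \<tau>
  proof (cases "l = 0")
    case True
    obtain \<pi> where \<pi>: "\<pi> permutes {1..n}" "real (dist \<pi> ps) \<le> R" "\<tau> = coarsen n (s 0) \<pi>"
      using \<tau> True by (auto simp: Ball_def)
    have "dist \<tau> ps \<le> dist \<tau> \<pi> + dist \<pi> ps" by (rule card_discordant_triangle)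
    moreover have "dist \<tau> \<pi> \<le> 2 * (n * s 0)"
      using card_discordant_coarsen[OF \<pi>(1) s0[of 0]] \<pi>(3) by (simp add: discordant_commute)
    moreover have "R \<le> 4 * real (n * s 0)" using R by (simp add: s_def)
    ultimately have "real (dist \<tau> ps) \<le> 2 * real (n * s 0) + 4 * real (n * s 0)"
      using \<pi>(2) by linarith
    then show ?thesis using True by (simp add: next_link_def)
  next
    case False
    have "\<tau> permutes {1..n}" using \<tau> coarsen_permutes unfolding Ball_def by blast
    then have "dist \<tau> (next_link l \<tau>) \<le> 2 * n * s (l - 1)"
      using False card_discordant_coarsen[of \<tau> n "s (l - 1)"] s0 by (simp add: next_link_def)
    also have "\<dots> \<le> 10 * n * s l" using step False l by simp
    finally show ?thesis by (metis of_nat_le_iff of_nat_mult of_nat_numeral)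
  qed
  have count: "real (card (coarsen n (s l) ` Ball)) \<le> exp (n * (11 + 2 * real l))" if l: "l \<le> K" for l
  proof -
    \<comment> \<open>In units of \<open>s l\<close> the ball has radius of order
      \<open>n * 4 ^ l\<close>. This \<open>\<theta>\<close> keeps the exponential factor at
      \<open>exp (9 * n)\<close>, leaving \<open>(4 ^ Suc l) ^ n\<close> as the cost of
      refinement.\<close>
    let ?\<theta> = "1 / 4 ^ l :: real"
    have pw: "(4::real) ^ l * 4 ^ (K - l) = 4 ^ K" using l by (simp flip: power_add)
    have "real (card (coarsen n (s l) ` Ball)) \<le> exp (?\<theta> * (n + 2 * R / s l)) * (4 / ?\<theta>) ^ n"
      unfolding Ball_def using s0 ps by (intro card_coarsen_ball_le) auto
    also have "\<dots> \<le> exp (9 * real n) * exp (2 + 2 * real l) ^ n"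
    proof (intro mult_mono power_mono)
      have "?\<theta> * (2 * R / s l) = 2 * R / (m * 4 ^ K)"
        using pw m0 by (simp add: s_def field_simps)
      also have "\<dots> \<le> 2 * (4 * n * (m * 4 ^ K)) / (m * 4 ^ K)"
        using R by (intro divide_right_mono) (auto simp: mult_ac)
      also have "\<dots> = 8 * n" using m0 by simp
      finally have "?\<theta> * (2 * R / s l) \<le> 8 * n" .
      moreover have "?\<theta> * n \<le> n" by (intro mult_left_le_one_le) auto
      ultimately show "exp (?\<theta> * (n + 2 * R / s l)) \<le> exp (9 * real n)"
        by (simp add: distrib_left)
      have "(4::real) \<le> exp 2"
        using exp_lower_Taylor_quadratic[of "2::real"] by simp
      then have "4 ^ Suc l \<le> exp (2::real) ^ Suc l" by (intro power_mono) auto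
      also have "\<dots> = exp (2 + 2 * real l)" by (simp add: exp_of_nat_mult[symmetric] exp_add mult.commute)
      finally show "4 / ?\<theta> \<le> exp (2 + 2 * real l)" by simp
    qed auto
    also have "\<dots> = exp (n * (11 + 2 * real l))"
      by (simp add: exp_of_nat_mult[symmetric] exp_add[symmetric] algebra_simps)
    finally show ?thesis .
  qed
  have bad_le: "measure_pmf.prob obs (bad l) \<le> exp (- a) * (1/2) ^ Suc l" if l: "l \<le> K" for l
  proof -
    define t where "t = 2 ^ l / sqrt Y"
    have pw: "(4::real) ^ l * 4 ^ (K - l) = 4 ^ K" using l by (simp flip: power_add)
    have "(4::real) ^ l \<le> 4 ^ K" using l by (intro power_increasing) auto
    then have "4 ^ l \<le> Y" using Ylow by (rule order_trans)
    then have "sqrt (4 ^ l) \<le> sqrt Y" by simp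
    moreover have "sqrt (4 ^ l) = (2::real) ^ l" by (simp add: real_sqrt_power)
    ultimately have t: "0 < t" "t \<le> 1" using Ypos by (auto simp: t_def)
    have tu: "t * u l = n * (22 + a + 3 * real l)" using Ypos by (simp add: t_def u_def)
    have "t\<^sup>2 = 4 ^ l / Y"
      using Ypos by (simp add: t_def power_divide power_mult[symmetric] mult.commute[of l])
        (simp add: power_mult)
    then have "t\<^sup>2 * p * (10 * n * s l) = (4 ^ l * 4 ^ (K - l)) * (p * m) * (10 * n) / Y"
      by (simp add: s_def)
    also have "\<dots> = Y * (10 * n) / Y" unfolding pw Y_def by simp
    \<comment> \<open>The variance term is the same at every level: \<open>t\<^sup>2\<close> grows
      by the factor 4 by which \<open>s l\<close> shrinks.\<close>
    finally have tp: "t\<^sup>2 * p * (10 * n * s l) = 10 * n" using Ypos by simp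
    have "measure_pmf.prob obs (bad l) \<le>
        (\<Sum>\<tau>\<in>coarsen n (s l) ` Ball. measure_pmf.prob obs {x. u l \<le> noise \<tau> (next_link l \<tau>) x})"
      unfolding bad_def using finB
      by (intro measure_pmf.finite_measure_subadditive_finite) auto
    also have "\<dots> \<le> (\<Sum>\<tau>\<in>coarsen n (s l) ` Ball. exp (- (n * (22 + a + 3 * real l)) + 10 * n))"
    proof (rule sum_mono)
      fix \<tau> assume \<tau>: "\<tau> \<in> coarsen n (s l) ` Ball"
      have "t\<^sup>2 * p * dist \<tau> (next_link l \<tau>) \<le> t\<^sup>2 * p * (10 * n * s l)"
        using link[OF \<tau> l] p by (intro mult_left_mono) auto
      then show "measure_pmf.prob obs {x. u l \<le> noise \<tau> (next_link l \<tau>) x}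
          \<le> exp (- (n * (22 + a + 3 * real l)) + 10 * n)"
        using noise_tail[OF t, of "u l" \<tau> "next_link l \<tau>"] unfolding tu tp
        by (elim order_trans) simp
    qed
    also have "\<dots> \<le> exp (n * (11 + 2 * real l)) * exp (- (n * (22 + a + 3 * real l)) + 10 * n)"
      using count[OF l] by (simp add: mult_right_mono)
    also have "\<dots> = exp (- (n * (1 + l + a)))" by (simp add: exp_add[symmetric] algebra_simps)
    also have "\<dots> \<le> exp (- (1 + l + a))"
    proof -
      have "1 * (1 + l + a) \<le> n * (1 + l + a)" using n a by (intro mult_right_mono) auto
      then show ?thesis by simp
    qed
    also have "\<dots> = exp (- a) * exp (-1) ^ Suc l"
      by (simp add: exp_of_nat_mult[symmetric] exp_add[symmetric] algebra_simps)
    also have "\<dots> \<le> exp (- a) * (1/2) ^ Suc l"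
    proof (intro mult_left_mono power_mono)
      have "(2::real) \<le> exp 1" using exp_ge_add_one_self[of "1::real"] by simp
      then show "exp (- 1) \<le> (1 / 2 :: real)" by (simp add: exp_minus field_simps)
    qed auto
    finally show ?thesis .
  qed
  have "{x. \<exists>\<pi>\<in>sieve n m. real (dist \<pi> ps) \<le> R \<and> n * sqrt Y * (50 + 2 * a) \<le> noise \<pi> ps x}
      \<subseteq> (\<Union>l\<in>{..K}. bad l)"
  proof
    fix x assume "x \<in> {x. \<exists>\<pi>\<in>sieve n m. real (dist \<pi> ps) \<le> R \<and> n * sqrt Y * (50 + 2 * a) \<le> noise \<pi> ps x}"
    then obtain \<pi> where \<pi>: "\<pi> \<in> sieve n m" "real (dist \<pi> ps) \<le> R" "n * sqrt Y * (50 + 2 * a) \<le> noise \<pi> ps x"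
      by auto
    have perm: "\<pi> permutes {1..n}" using \<pi>(1) by (rule sieve_permutes)
    show "x \<in> (\<Union>l\<in>{..K}. bad l)"
    proof (rule ccontr)
      assume "x \<notin> (\<Union>l\<in>{..K}. bad l)"
      then have "noise (coarsen n (s l) \<pi>) (next_link l (coarsen n (s l) \<pi>)) x \<le> u l" if "l \<le> K" for l
        using that \<pi>(2) perm by (force simp: bad_def Ball_def not_le intro: less_imp_le)
      then have "(\<Sum>l\<le>K. noise (coarsen n (s l) \<pi>) (next_link l (coarsen n (s l) \<pi>)) x) \<le> (\<Sum>l\<le>K. u l)"
        by (intro sum_mono) auto
      also have "\<dots> = n * sqrt Y * (2 * (22 + a) + 6 - (22 + a + 3 * real K + 6) / 2 ^ K)"
        unfolding u_def sum_distrib_left[symmetric] sum_linear_geometric_half by simp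
      also have "\<dots> < n * sqrt Y * (50 + 2 * a)"
        using n Ypos a by (intro mult_strict_left_mono) (auto simp: field_simps intro!: add_pos_nonneg)
      \<comment> \<open>At \<open>l = K\<close> the block length is \<open>m\<close>, and coarsening
        fixes members of the sieve, so the chain ends at \<open>\<pi>\<close> itself.\<close>
      finally show False
        using chain[OF perm, of K x] coarsen_sieve[OF \<pi>(1)] \<pi>(3) by (simp add: s_def)
    qed
  qed
  then have "measure_pmf.prob obs {x. \<exists>\<pi>\<in>sieve n m. real (dist \<pi> ps) \<le> R \<and>
      n * sqrt Y * (50 + 2 * a) \<le> noise \<pi> ps x} \<le> measure_pmf.prob obs (\<Union>l\<in>{..K}. bad l)"
    by (intro measure_pmf.finite_measure_mono) auto
  also have "\<dots> \<le> (\<Sum>l\<in>{..K}. measure_pmf.prob obs (bad l))"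
    by (intro measure_pmf.finite_measure_subadditive_finite) auto
  also have "\<dots> \<le> (\<Sum>l\<le>K. exp (- a) * (1/2) ^ Suc l)" by (intro sum_mono bad_le) auto
  also have "\<dots> = exp (- a) * (1 - (1/2) ^ Suc K)"
    unfolding sum_distrib_left[symmetric] sum_geometric_half ..
  also have "\<dots> \<le> exp (- a)" by (simp add: mult_left_le)
  finally show ?thesis .
qed

end

section \<open>The sieve estimator\<close>

context noisy_sorting
begin

definition block :: nat where "block = nat \<lceil>1 / p\<rceil>"

text \<open>Rounding up secures \<open>p * block \<ge> 1\<close> for the chaining; since
  \<open>1 / p \<ge> 1\<close>, it at most doubles the length.\<close>

lemma block_bounds: "1 \<le> p * block" "p * block \<le> 2" "real block \<le> 2 / p" "block > 0"
proof -
  have pos: "1 \<le> 1 / p" using p by simp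
  then have "0 < \<lceil>1 / p\<rceil>" by linarith
  then have eq: "real block = of_int \<lceil>1 / p\<rceil>" by (simp add: block_def)
  then show "block > 0" using \<open>0 < \<lceil>1 / p\<rceil>\<close> by (simp add: block_def)
  have lo: "1 / p \<le> real block" unfolding eq by (rule le_of_int_ceiling)
  have "real block < 1 / p + 1" unfolding eq by linarith
  then show up: "real block \<le> 2 / p" using pos by simp
  show "1 \<le> p * block" using lo p by (simp add: field_simps)
  show "p * block \<le> 2" using up p by (simp add: field_simps)
qed

text \<open>An estimate farther than \<open>r\<close> from the truth forces a large noise. The bias caused by
  restricting to the sieve is at most \<open>p * (2 n block) \<le> 4 n\<close>, harmless against the drift
  \<open>2 lam p r\<close>, even though the comparison probabilities of the affected pairs may be extreme.\<close>

lemma estimate_peeling: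
  fixes a r :: real
  assumes e: "\<And>x. e x \<in> sieve n block"
    and emax: "\<And>x \<sigma>. \<sigma> \<in> sieve n block \<Longrightarrow> score n \<sigma> x \<le> score n (e x) x"
    and a: "0 \<le> a" and r: "(58 + 3 * a)\<^sup>2 \<le> lam\<^sup>2 * p * r / (2 * n)"
  shows "measure_pmf.prob obs {x. r < dist (e x) ps \<and> dist (e x) ps \<le> 2 * r} \<le> 2 * exp (- a)"
proof -
  \<comment> \<open>The ball radius \<open>2 * r\<close> per item. Bracketing \<open>y\<close> fixes
    the coarsest scale: \<open>block * 4 ^ K \<le> y\<close> bounds the drift from below by
    \<open>n * (lam * Y)\<close>, and the upper bracket is the radius condition of the chaining
    bound.\<close>
  define y where "y = 2 * r / n"
  \<comment> \<open>The truth need not lie in the sieve; its coarsening is the competitor that the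
    maximiser must beat.\<close>
  define \<sigma> where "\<sigma> = coarsen n block ps"
  have n0: "0 < real n" using n by simp
  have "2 \<le> (58 + 3 * a)\<^sup>2" using a power_mono[of 58 "58 + 3 * a" 2] by simp
  then have "2 \<le> lam\<^sup>2 * (p * r / (2 * n))" using r by simp
  moreover have lam2: "lam\<^sup>2 \<le> 1" using lam by (simp add: power_le_one)
  ultimately have pr: "2 \<le> p * r / (2 * n)"
    by (smt (verit) mult_left_le_one_le mult_nonneg_nonpos zero_le_power2)
  then have "2 / p \<le> y" using p n0 by (simp add: y_def field_simps)
  then have "real block \<le> y" using block_bounds(3) by linarith
  then obtain K where K: "block * 4 ^ K \<le> y" "y < block * 4 ^ Suc K"
    using ex_power4_bracket[of "real block" y] block_bounds(4) by auto
  define Y where "Y = p * (block * 4 ^ K)"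
  have Ylow: "1 \<le> Y"
  proof -
    have "1 * 1 \<le> (p * block) * 4 ^ K" using block_bounds(1) by (intro mult_mono) auto
    then show ?thesis by (simp add: Y_def mult.assoc)
  qed
  have "p * r / (2 * n) = p * (y / 4)" by (simp add: y_def)
  also have "\<dots> < Y" using K(2) p by (simp add: Y_def)
  finally have "lam\<^sup>2 * (p * r / (2 * n)) < lam\<^sup>2 * Y" using lam by (intro mult_strict_left_mono) auto
  then have "(58 + 3 * a)\<^sup>2 < (lam * sqrt Y)\<^sup>2"
    using r Ylow by (simp add: power_mult_distrib)
  \<comment> \<open>This makes the drift win: \<open>58 + 3 * a\<close> collects
    \<open>50 + 2 * a\<close> for the chaining, \<open>4 + a\<close> for \<open>E2\<close> and 4 for
    the sieve bias.\<close>
  then have large: "58 + 3 * a < lam * sqrt Y"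
    by (rule power2_less_imp_less) (use lam Ylow in simp)
  define E1 where "E1 = {x. \<exists>\<pi>\<in>sieve n block. real (dist \<pi> ps) \<le> 2 * r \<and>
      n * sqrt Y * (50 + 2 * a) \<le> noise \<pi> ps x}"
  define E2 where "E2 = {x. n * (4 + a) \<le> noise ps \<sigma> x}"
  have "2 * r = n * y" using n0 by (simp add: y_def)
  also have "\<dots> \<le> real n * real (block * 4 ^ Suc K)" using K(2) by (intro mult_left_mono) auto
  finally have "2 * r \<le> 4 * n * (block * 4 ^ K)" by simp
  then have p1: "measure_pmf.prob obs E1 \<le> exp (- a)"
    unfolding E1_def Y_def using noise_supremum_tail[OF a block_bounds(1), of "2 * r" K] by simp
  have d\<sigma>: "p * dist ps \<sigma> \<le> 4 * n"
  proof -
    have "real (dist ps \<sigma>) \<le> 2 * n * real block"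
      using card_discordant_coarsen[OF ps block_bounds(4)]
      unfolding \<sigma>_def by (metis of_nat_le_iff of_nat_mult of_nat_numeral)
    then have "p * dist ps \<sigma> \<le> p * (2 * n * real block)" using p by simp
    also have "\<dots> = 2 * n * (p * block)" by simp
    also have "\<dots> \<le> real (2 * n) * 2" using block_bounds(2) by (intro mult_left_mono) auto
    finally show ?thesis by simp
  qed
  have "measure_pmf.prob obs E2 \<le> exp (- (1 * (n * (4 + a))) + 1\<^sup>2 * p * dist ps \<sigma>)"
    unfolding E2_def by (rule noise_tail) auto
  also have "\<dots> \<le> exp (- a)"
  proof -
    have "a * 1 \<le> a * n" using a n by (intro mult_left_mono) auto
    then show ?thesis using d\<sigma> by (simp add: algebra_simps)
  qed
  finally have p2: "measure_pmf.prob obs E2 \<le> exp (- a)" .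
  have "{x. r < dist (e x) ps \<and> dist (e x) ps \<le> 2 * r} \<subseteq> E1 \<union> E2"
  proof
    fix x assume x: "x \<in> {x. r < dist (e x) ps \<and> dist (e x) ps \<le> 2 * r}"
    show "x \<in> E1 \<union> E2"
    proof (rule ccontr)
      assume "x \<notin> E1 \<union> E2"
      then have n1: "noise (e x) ps x < n * sqrt Y * (50 + 2 * a)" and n2: "noise ps \<sigma> x < n * (4 + a)"
        using x e[of x] by (auto simp: E1_def E2_def not_le)
      have "\<sigma> \<in> sieve n block" using ps by (auto simp: sieve_def \<sigma>_def)
      then have sc: "score n \<sigma> x \<le> score n (e x) x" by (rule emax)
      let ?d = "\<lambda>\<pi>. \<Sum>q\<in>item_pairs n. weight \<pi> ps q * mean q"
      have "(score n (e x) x - score n ps x) / 2 = noise (e x) ps x + p * ?d (e x)"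
        "(score n \<sigma> x - score n ps x) / 2 = noise \<sigma> ps x + p * ?d \<sigma>"
        by (rule score_diff)+
      then have "noise \<sigma> ps x + p * ?d \<sigma> \<le> noise (e x) ps x + p * ?d (e x)" using sc by argo
      moreover have "noise \<sigma> ps x = - noise ps \<sigma> x"
        using noise_trans[of ps ps x \<sigma>] by (simp add: noise_refl)
      moreover have "p * (- real (dist ps \<sigma>)) \<le> p * ?d \<sigma>"
        using drift_bounds(2)[of \<sigma>] p by (intro mult_left_mono) (auto simp: discordant_commute)
      moreover have "p * ?d (e x) \<le> - (n * (lam * Y))"
      proof -
        have "real n * real (block * 4 ^ K) \<le> n * y" using K(1) by (intro mult_left_mono) auto
        also have "\<dots> = 2 * r" using n0 by (simp add: y_def)
        also have "\<dots> \<le> 2 * dist (e x) ps" using x by simp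
        finally have "p * lam * (real n * real (block * 4 ^ K)) \<le> p * lam * (2 * dist (e x) ps)"
          using p lam by (intro mult_left_mono) auto
        moreover have "p * ?d (e x) \<le> p * (- (2 * lam * dist (e x) ps))"
          using drift_bounds(1)[of "e x"] p by (intro mult_left_mono) auto
        ultimately show ?thesis by (simp add: Y_def algebra_simps)
      qed
      ultimately have "n * (lam * Y) < n * sqrt Y * (50 + 2 * a) + n * (4 + a) + 4 * n"
        using n1 n2 d\<sigma> by (simp add: algebra_simps)
      also have "\<dots> = n * (sqrt Y * (50 + 2 * a) + (8 + a))" by (simp add: algebra_simps)
      finally have "lam * Y < sqrt Y * (50 + 2 * a) + (8 + a)" using n0 by simp
      also have "\<dots> \<le> sqrt Y * (50 + 2 * a) + sqrt Y * (8 + a)"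
        using Ylow a mult_right_mono[of 1 "sqrt Y" "8 + a"] by simp
      also have "\<dots> = sqrt Y * (58 + 3 * a)" by (simp add: algebra_simps)
      also have "\<dots> < sqrt Y * (lam * sqrt Y)" using large Ylow by (intro mult_strict_left_mono) auto
      also have "\<dots> = lam * Y" using Ylow by simp
      finally show False by simp
    qed
  qed
  then have "measure_pmf.prob obs {x. r < dist (e x) ps \<and> dist (e x) ps \<le> 2 * r}
      \<le> measure_pmf.prob obs (E1 \<union> E2)"
    by (intro measure_pmf.finite_measure_mono) auto
  also have "\<dots> \<le> measure_pmf.prob obs E1 + measure_pmf.prob obs E2"
    by (intro measure_Un_le) auto
  finally show ?thesis using p1 p2 by simp
qed

text \<open>Dyadic shells: the radius doubles while the probability bound falls by 4, so the shells
  contribute at most \<open>8 * r 0\<close>. With the inner ball this is \<open>9 * r 0\<close>, and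
  \<open>9 * 6728 = 60552\<close>.\<close>

lemma expected_distance_le:
  assumes e: "\<And>x. e x \<in> sieve n block"
    and emax: "\<And>x \<sigma>. \<sigma> \<in> sieve n block \<Longrightarrow> score n \<sigma> x \<le> score n (e x) x"
  shows "expect obs (\<lambda>x. real (dist (e x) ps)) \<le> 60552 * (n / (p * lam\<^sup>2))"
proof -
  \<comment> \<open>As \<open>6728 = 2 * 58\<^sup>2\<close>, the condition for peeling at shell
    \<open>j\<close> reads \<open>(58 + 3 * a)\<^sup>2 \<le> 58\<^sup>2 * 2 ^ j\<close>, which
    \<open>a = 2 * j\<close> satisfies.\<close>
  define r where "r j = 6728 * (n / (p * lam\<^sup>2)) * 2 ^ j" for j :: nat
  have n0: "0 < real n" using n by simp
  have r0: "0 < r 0" using n0 p lam by (simp add: r_def)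
  have rpos: "0 < r j" for j using n0 p lam by (simp add: r_def)
  define shell where "shell j = {x. r j < dist (e x) ps \<and> dist (e x) ps \<le> 2 * r j}" for j
  have shell_le: "measure_pmf.prob obs (shell j) \<le> 2 * (1/4) ^ j" for j
  proof -
    have "lam\<^sup>2 * p * r j / (2 * n) = 3364 * 2 ^ j"
      using n0 p lam by (simp add: r_def field_simps)
    then have "(58 + 3 * (2 * real j))\<^sup>2 \<le> lam\<^sup>2 * p * r j / (2 * n)"
      using quadratic_le_exponential[of j] by simp
    then have "measure_pmf.prob obs (shell j) \<le> 2 * exp (- (2 * real j))"
      unfolding shell_def by (intro estimate_peeling[OF e emax]) auto
    also have "exp (- (2 * real j)) = exp (-2) ^ j" by (simp add: exp_of_nat_mult[symmetric] mult.commute)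
    also have "\<dots> \<le> (1/4) ^ j"
    proof (rule power_mono)
      have "(4::real) \<le> exp 2" using exp_lower_Taylor_quadratic[of "2::real"] by simp
      then show "exp (-2) \<le> (1/4 :: real)" by (simp add: exp_minus field_simps)
    qed auto
    finally show ?thesis by simp
  qed
  obtain J where J: "real (n\<^sup>2) / r 0 < 2 ^ J" using real_arch_pow[of 2 "real (n\<^sup>2) / r 0"] by auto
  have cover: "real k \<le> r 0 + (\<Sum>j<L. 2 * r j * of_bool (r j < k \<and> k \<le> 2 * r j))"
    if "real k \<le> r L" for k L
    using that
  proof (induction L)
    case (Suc L)
    have nonneg: "0 \<le> (\<Sum>j<L. 2 * r j * of_bool (r j < k \<and> k \<le> 2 * r j))"
      using rpos by (intro sum_nonneg) (auto intro: less_imp_le)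
    have "r (Suc L) = 2 * r L" by (simp add: r_def)
    then show ?case
      using Suc nonneg r0 rpos[of L] by (cases "real k \<le> r L") auto
  qed simp
  have pt: "real (dist (e x) ps) \<le> r 0 + (\<Sum>j<J. 2 * r j * indicator (shell j) x)" for x
  proof -
    have "dist (e x) ps = kendall_tau n (e x) ps"
      using sieve_permutes[OF e] ps by (simp add: kendall_tau_eq_card_discordant)
    also have "\<dots> \<le> n\<^sup>2" by (rule kendall_tau_le)
    finally have "real (dist (e x) ps) \<le> real (n\<^sup>2)" by (simp only: of_nat_le_iff)
    also have "real (n\<^sup>2) \<le> r J" proof -
      have "r J = 2 ^ J * r 0" by (simp add: r_def)
      then show ?thesis using J r0 by (simp only: pos_divide_less_eq less_imp_le)
    qed
    finally show ?thesis
      using cover[of "dist (e x) ps" J] by (simp add: shell_def indicator_def of_bool_def)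
  qed
  have "expect obs (\<lambda>x. real (dist (e x) ps)) \<le>
      expect obs (\<lambda>x. r 0 + (\<Sum>j<J. 2 * r j * indicator (shell j) x))"
    by (intro integral_mono integrable_measure_pmf_finite finite_obs pt)
  also have "\<dots> = r 0 + (\<Sum>j<J. 2 * r j * measure_pmf.prob obs (shell j))"
  proof -
    have int: "integrable (measure_pmf obs) f" for f :: "observation \<Rightarrow> real"
      by (intro integrable_measure_pmf_finite finite_obs)
    have "expect obs (\<lambda>x. r 0 + (\<Sum>j<J. 2 * r j * indicator (shell j) x)) =
        r 0 + expect obs (\<lambda>x. \<Sum>j<J. 2 * r j * indicator (shell j) x)"
      by (subst Bochner_Integration.integral_add[OF int int]) simp
    also have "expect obs (\<lambda>x. \<Sum>j<J. 2 * r j * indicator (shell j) x) =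
        (\<Sum>j<J. expect obs (\<lambda>x. 2 * r j * indicator (shell j) x))"
      by (rule Bochner_Integration.integral_sum) (rule int)
    finally show ?thesis by simp
  qed
  also have "\<dots> \<le> r 0 + (\<Sum>j<J. 2 * r j * (2 * (1/4) ^ j))"
    using rpos by (intro add_left_mono sum_mono mult_left_mono shell_le) (auto intro: less_imp_le)
  also have "(\<Sum>j<J. 2 * r j * (2 * (1/4) ^ j)) = r 0 * (\<Sum>j<J. 4 * (1/2) ^ j)"
    unfolding sum_distrib_left
  proof (intro sum.cong refl)
    fix j
    have "(2::real) ^ j * (1/4) ^ j = (1/2) ^ j" by (simp add: power_mult_distrib[symmetric])
    then show "2 * r j * (2 * (1/4) ^ j) = r 0 * (4 * (1/2) ^ j)"
      by (simp add: r_def)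
  qed
  also have "(\<Sum>j<J. 4 * (1/2) ^ j) = 8 * (1 - (1/2 :: real) ^ J)"
    by (induction J) (simp_all add: right_diff_distrib)
  also have "r 0 + r 0 * (8 * (1 - (1/2 :: real) ^ J)) \<le> 9 * r 0"
    using r0 by (simp add: algebra_simps)
  also have "\<dots> = 60552 * (n / (p * lam\<^sup>2))" by (simp add: r_def)
  finally show ?thesis by simp
qed

end

lemma minimax_risk_upper:
  assumes n: "1 \<le> n" and p: "0 < p" "p \<le> 1" and lam: "0 < lam" "lam < 1/2"
    and S: "regular_sampling n p S"
  shows "minimax_risk n lam S \<le> 60552 * min (n / (p * lam\<^sup>2)) ((real n)\<^sup>2)"
proof -
  \<comment> \<open>A copy of \<open>block\<close>: the estimator has to be defined before the truth
    and the matrix are fixed, whereas the locale is interpreted afterwards.\<close>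
  define m where "m = nat \<lceil>1 / p\<rceil>"
  define est where "est x = (ARG_MAX (\<lambda>\<pi>. score n \<pi> x) \<pi>. \<pi> \<in> sieve n m)" for x
  have fin: "finite (sieve n m)" by (simp add: sieve_def finite_permutations)
  have ne: "sieve n m \<noteq> {}" unfolding sieve_def using permutes_id by blast
  have argmax: "is_arg_max (\<lambda>\<pi>. score n \<pi> x) (\<lambda>\<pi>. \<pi> \<in> sieve n m) (est x)" for x
  proof -
    let ?X = "(\<lambda>\<pi>. score n \<pi> x) ` sieve n m"
    have "Max ?X \<in> ?X" using fin ne by (intro Max_in) auto
    then obtain \<pi> where \<pi>: "\<pi> \<in> sieve n m" "score n \<pi> x = Max ?X" by auto
    then have "\<forall>\<sigma>\<in>sieve n m. score n \<sigma> x \<le> score n \<pi> x" using fin by auto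
    then have "is_arg_max (\<lambda>\<pi>. score n \<pi> x) (\<lambda>\<pi>. \<pi> \<in> sieve n m) \<pi>"
      using \<pi>(1) by (auto simp: is_arg_max_def not_less)
    then show ?thesis unfolding est_def arg_max_def
      by (rule someI[of "is_arg_max (\<lambda>\<pi>. score n \<pi> x) (\<lambda>\<pi>. \<pi> \<in> sieve n m)"])
  qed
  then have est: "est x \<in> sieve n m" "\<And>\<sigma>. \<sigma> \<in> sieve n m \<Longrightarrow> score n \<sigma> x \<le> score n (est x) x" for x
    by (auto simp: is_arg_max_def not_less)
  have risk: "risk n S est \<pi> M \<le> 60552 * min (n / (p * lam\<^sup>2)) ((real n)\<^sup>2)"
    if \<pi>: "\<pi> permutes {1..n}" and M: "M \<in> comparison_matrices n lam" for \<pi> M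
  proof -
    interpret noisy_sorting n p lam S \<pi> M
      by unfold_locales (fact n p lam S \<pi> M)+
    have blk: "block = m" by (simp add: m_def block_def)
    have "risk n S est \<pi> M = expect obs (\<lambda>x. real (dist (est x) \<pi>))"
      unfolding risk_def obs_def
      using sieve_permutes[OF est(1)] \<pi> by (simp add: kendall_tau_eq_card_discordant)
    also have "\<dots> \<le> 60552 * (n / (p * lam\<^sup>2))"
      using est unfolding blk[symmetric] by (rule expected_distance_le)
    moreover have "risk n S est \<pi> M \<le> 60552 * (real n)\<^sup>2"
      using risk_le[of n S est \<pi> M] zero_le_power2[of "real n"] unfolding of_nat_power by argo
    ultimately show ?thesis by (simp add: min_def)
  qed
  have "minimax_risk n lam S \<le> worst_risk n lam S est"
    unfolding minimax_risk_def
  proof (rule cINF_lower)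
    show "est \<in> estimators n" using sieve_permutes[OF est(1)] by (auto simp: estimators_def)
    have "0 \<le> worst_risk n lam S est'" for est'
    proof -
      obtain M where M: "M \<in> comparison_matrices n lam"
        using comparison_matrices_nonempty[OF lam] by blast
      have "0 \<le> risk n S est' id M" unfolding risk_def by (intro integral_nonneg_AE) auto
      also have "\<dots> = (\<lambda>(\<pi>, M). risk n S est' \<pi> M) (id, M)" by simp
      also have "\<dots> \<le> worst_risk n lam S est'"
        unfolding worst_risk_def using M permutes_id
        by (intro cSUP_upper bdd_above_risk) auto
      finally show ?thesis .
    qed
    then show "bdd_below (worst_risk n lam S ` estimators n)" by (intro bdd_belowI2[of _ 0]) auto
  qed
  also have "\<dots> \<le> 60552 * min (n / (p * lam\<^sup>2)) ((real n)\<^sup>2)"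
    unfolding worst_risk_def
  proof (rule cSUP_least)
    show "{\<pi>. \<pi> permutes {1..n}} \<times> comparison_matrices n lam \<noteq> {}"
      using comparison_matrices_nonempty[OF lam, of n] permutes_id[of "{1..n}"] by blast
  qed (use risk in \<open>auto simp del: One_nat_def\<close>)
  finally show ?thesis .
qed

section \<open>Lower bound\<close>

text \<open>All gaps equal \<open>lam\<close>, so the law of a comparison depends only on the order
  of the two items, and a discordant pair merely exchanges its two probabilities.\<close>

definition extremal_matrix :: "real \<Rightarrow> nat \<Rightarrow> nat \<Rightarrow> real" where
  "extremal_matrix lam i j = (if i > j then 1/2 + lam else if i < j then 1/2 - lam else 1/2)"

lemma extremal_matrix_in:
  assumes "0 < lam" "lam < 1/2"
  shows "extremal_matrix lam \<in> comparison_matrices n lam"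
  using assms by (auto simp: comparison_matrices_def extremal_matrix_def)

section \<open>Two-point testing by Hellinger affinity\<close>

lemma testing_lower_bound:
  fixes P P' :: "'a pmf" and H :: "'a \<Rightarrow> real"
  assumes F: "finite F" "set_pmf P \<subseteq> F" "set_pmf P' \<subseteq> F"
    and H: "\<And>x. x \<in> F \<Longrightarrow> pmf P' x = (H x)\<^sup>2 * pmf P x"
  shows "(expect P H)\<^sup>2 / 2 \<le> measure_pmf.prob P A + measure_pmf.prob P' (- A)"
proof -
  define \<rho> where "\<rho> = expect P H"
  define e where "e = measure_pmf.prob P A + measure_pmf.prob P' (- A)"
  have \<rho>: "\<rho> = (\<Sum>x\<in>F. H x * pmf P x)"
    unfolding \<rho>_def using F by (intro integral_measure_pmf_real) auto
  have pr: "measure_pmf.prob Q B = (\<Sum>x\<in>F. indicator B x * pmf Q x)" if "set_pmf Q \<subseteq> F" for Q B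
  proof -
    have "measure_pmf.prob Q B = expect Q (indicator B)" by simp
    also have "\<dots> = (\<Sum>x\<in>F. indicator B x * pmf Q x)"
      using F(1) that by (intro integral_measure_pmf_real) auto
    finally show ?thesis .
  qed
  have one: "(\<Sum>x\<in>F. pmf P x) = 1" "(\<Sum>x\<in>F. pmf P' x) = 1"
    using F by (auto intro: sum_pmf_eq_1)
  have "\<rho>\<^sup>2 \<le> 2 * e"
  proof (cases "\<rho> = 0")
    case True
    then show ?thesis by (simp add: e_def)
  next
    case False
    \<comment> \<open>\<open>H\<close> is a square root of the likelihood ratio and
      \<open>\<rho>\<close> plays the part of the affinity. This \<open>\<eta>\<close> maximises
      \<open>2 * \<eta> * \<bar>\<rho>\<bar> - 2 * \<eta>\<^sup>2\<close>, the lower bound on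
      \<open>e\<close> obtained below.\<close>
    define \<eta> where "\<eta> = \<bar>\<rho>\<bar> / 2"
    have \<eta>: "0 < \<eta>" using False by (simp add: \<eta>_def)
    have pt: "2 * \<eta> * (\<bar>H x\<bar> * pmf P x) \<le> indicator A x * pmf P x + indicator (- A) x * pmf P' x +
        \<eta>\<^sup>2 * (pmf P x + pmf P' x)" if "x \<in> F" for x
    proof -
      define h where "h = \<bar>H x\<bar>"
      have h2: "(H x)\<^sup>2 = h\<^sup>2" by (simp add: h_def)
      \<comment> \<open>One square serves the points of \<open>A\<close>, charged to
        \<open>P\<close>; the other serves its complement, where the charge to \<open>P'\<close> is
        \<open>h\<^sup>2\<close> times that to \<open>P\<close>.\<close>
      have "0 \<le> (1 - \<eta> * h)\<^sup>2 + \<eta>\<^sup>2" "0 \<le> (\<eta> - h)\<^sup>2 + \<eta>\<^sup>2 * h\<^sup>2" by simp_all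
      then have "2 * \<eta> * h \<le> 1 + \<eta>\<^sup>2 * (1 + h\<^sup>2)" "2 * \<eta> * h \<le> h\<^sup>2 + \<eta>\<^sup>2 * (1 + h\<^sup>2)"
        by (simp_all add: power2_eq_square algebra_simps)
      then have "2 * \<eta> * h * pmf P x \<le> (1 + \<eta>\<^sup>2 * (1 + h\<^sup>2)) * pmf P x"
        "2 * \<eta> * h * pmf P x \<le> (h\<^sup>2 + \<eta>\<^sup>2 * (1 + h\<^sup>2)) * pmf P x"
        by (auto intro!: mult_right_mono)
      then show ?thesis
        using H[OF that] unfolding h2 h_def[symmetric]
        by (cases "x \<in> A") (simp_all add: algebra_simps)
    qed
    have "2 * \<eta> * \<bar>\<rho>\<bar> \<le> 2 * \<eta> * (\<Sum>x\<in>F. \<bar>H x\<bar> * pmf P x)"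
      unfolding \<rho> using \<eta> sum_abs[of "\<lambda>x. H x * pmf P x" F]
      by (intro mult_left_mono) (auto simp: abs_mult)
    also have "\<dots> = (\<Sum>x\<in>F. 2 * \<eta> * (\<bar>H x\<bar> * pmf P x))" by (simp add: sum_distrib_left)
    also have "\<dots> \<le> (\<Sum>x\<in>F. indicator A x * pmf P x + indicator (- A) x * pmf P' x +
        \<eta>\<^sup>2 * (pmf P x + pmf P' x))" by (intro sum_mono pt)
    also have "\<dots> = e + \<eta>\<^sup>2 * 2"
      unfolding e_def using pr[OF F(2), of A] pr[OF F(3), of "- A"] one
      by (simp add: sum.distrib sum_distrib_left[symmetric])
    finally show ?thesis by (simp add: \<eta>_def power2_eq_square field_simps)
  qed
  then show ?thesis by (simp add: \<rho>_def e_def)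
qed

text \<open>A comparison of a discordant pair has affinity
  \<open>2 * sqrt (\<theta> * (1 - \<theta>))\<close>, whose square is
  \<open>1 - 4 * lam\<^sup>2\<close>. With the counts fixed, the squared affinity is a product of
  powers, to which the generating function of the counts applies.\<close>

lemma outcomes_testing_lower_bound:
  assumes lam: "0 < lam" "lam < 1/2"
    and \<pi>: "\<pi> permutes {1..n}" and \<sigma>: "\<sigma> permutes {1..n}"
  defines "M \<equiv> extremal_matrix lam"
  shows "(\<Prod>q\<in>item_pairs n. (if q \<in> discordant n \<pi> \<sigma> then 1 - 4 * lam\<^sup>2 else 1) ^ c q) / 2
    \<le> measure_pmf.prob (outcomes n \<pi> M c) A + measure_pmf.prob (outcomes n \<sigma> M c) (- A)"
proof -
  define D where "D = discordant n \<pi> \<sigma>"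
  define I where "I = (SIGMA q : item_pairs n. {..<c q})"
  define \<theta> where "\<theta> \<tau> q = (if ranks_above \<tau> q then 1/2 + lam else 1/2 - lam)" for \<tau> q
  define h where "h q b = (if q \<in> D then
      (if b then sqrt ((1 - \<theta> \<pi> q) / \<theta> \<pi> q) else sqrt (\<theta> \<pi> q / (1 - \<theta> \<pi> q))) else 1)" for q b
  define H where "H w = (\<Prod>q\<in>item_pairs n. \<Prod>k<c q. h q (w (q, k)))" for w
  define F where "F = PiE_dflt I False (\<lambda>_. UNIV :: bool set)"
  have M: "M \<in> comparison_matrices n lam" unfolding M_def using lam by (rule extremal_matrix_in)
  have \<theta>01: "0 < \<theta> \<tau> q" "\<theta> \<tau> q < 1" for \<tau> q using lam by (auto simp: \<theta>_def)
  have M\<theta>: "M (\<tau> (fst q)) (\<tau> (snd q)) = \<theta> \<tau> q" if "\<tau> permutes {1..n}" "q \<in> item_pairs n" for \<tau> q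
  proof -
    have "fst q \<noteq> snd q" using that(2) by (auto simp: item_pairs_def)
    then have "\<tau> (fst q) \<noteq> \<tau> (snd q)" by (simp add: inj_eq[OF permutes_inj[OF that(1)]])
    then show ?thesis by (auto simp: M_def extremal_matrix_def \<theta>_def ranks_above_def)
  qed
  have finI: "finite I" by (simp add: I_def)
  have out: "outcomes n \<tau> M c = Pi_pmf I False (\<lambda>z. bernoulli_pmf (\<theta> \<tau> (fst z)))"
    if "\<tau> permutes {1..n}" for \<tau>
    unfolding outcomes_def I_def using M\<theta>[OF that]
    by (intro Pi_pmf_cong) (auto simp: case_prod_unfold)
  have "(expect (outcomes n \<pi> M c) H)\<^sup>2 / 2
    \<le> measure_pmf.prob (outcomes n \<pi> M c) A + measure_pmf.prob (outcomes n \<sigma> M c) (- A)"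
  proof (rule testing_lower_bound[of F])
    show "finite F" unfolding F_def using finI by (intro finite_PiE_dflt) auto
    show "set_pmf (outcomes n \<pi> M c) \<subseteq> F" "set_pmf (outcomes n \<sigma> M c) \<subseteq> F"
      unfolding out[OF \<pi>] out[OF \<sigma>] F_def using finI set_Pi_pmf_subset'[OF finI]
      by (fastforce simp: PiE_dflt_def)+
    fix w assume "w \<in> F"
    then have w: "\<And>z. z \<notin> I \<Longrightarrow> w z = False" by (auto simp: F_def PiE_dflt_def)
    have fac: "pmf (bernoulli_pmf (\<theta> \<sigma> q)) b = (h q b)\<^sup>2 * pmf (bernoulli_pmf (\<theta> \<pi> q)) b"
      if q: "q \<in> item_pairs n" for q b
    proof (cases "q \<in> D")
      case True
      then have "\<theta> \<sigma> q = 1 - \<theta> \<pi> q" by (auto simp: D_def discordant_def \<theta>_def)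
      then show ?thesis using True \<theta>01[of \<pi> q] by (cases b) (auto simp: h_def)
    next
      case False
      then have "\<theta> \<sigma> q = \<theta> \<pi> q" using q by (auto simp: D_def discordant_def \<theta>_def)
      then show ?thesis using False by (simp add: h_def)
    qed
    have "H w = (\<Prod>z\<in>I. h (fst z) (w z))"
      unfolding H_def I_def by (simp add: prod.Sigma case_prod_unfold)
    then have "(H w)\<^sup>2 * pmf (outcomes n \<pi> M c) w =
        (\<Prod>z\<in>I. (h (fst z) (w z))\<^sup>2 * pmf (bernoulli_pmf (\<theta> \<pi> (fst z))) (w z))"
      unfolding out[OF \<pi>] using w finI by (simp add: pmf_Pi' prod.distrib prod_power_distrib)
    also have "\<dots> = (\<Prod>z\<in>I. pmf (bernoulli_pmf (\<theta> \<sigma> (fst z))) (w z))"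
      using fac by (intro prod.cong) (auto simp: I_def)
    also have "\<dots> = pmf (outcomes n \<sigma> M c) w"
      unfolding out[OF \<sigma>] using w finI by (simp add: pmf_Pi')
    finally show "pmf (outcomes n \<sigma> M c) w = (H w)\<^sup>2 * pmf (outcomes n \<pi> M c) w" ..
  qed
  also have "expect (outcomes n \<pi> M c) H =
      (\<Prod>q\<in>item_pairs n. (\<theta> \<pi> q * h q True + (1 - \<theta> \<pi> q) * h q False) ^ c q)"
    unfolding H_def using \<theta>01[of \<pi>]
    by (subst expect_outcomes_prod[OF \<pi> M]) (auto simp: h_def less_imp_le M\<theta>[OF \<pi>])
  also have "\<dots>\<^sup>2 = (\<Prod>q\<in>item_pairs n. (if q \<in> D then 1 - 4 * lam\<^sup>2 else 1) ^ c q)"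
    unfolding prod_power_distrib
  proof (rule prod.cong[OF refl])
    fix q
    let ?t = "\<theta> \<pi> q"
    have "(?t * h q True + (1 - ?t) * h q False)\<^sup>2 = (if q \<in> D then 1 - 4 * lam\<^sup>2 else 1)"
    proof (cases "q \<in> D")
      case True
      have "?t * sqrt ((1 - ?t) / ?t) = sqrt (?t * (1 - ?t))"
        using \<theta>01[of \<pi> q] by (intro real_sqrt_unique[symmetric]) (simp_all add: power_mult_distrib, simp add: power2_eq_square)
      moreover have "(1 - ?t) * sqrt (?t / (1 - ?t)) = sqrt (?t * (1 - ?t))"
        using \<theta>01[of \<pi> q] by (intro real_sqrt_unique[symmetric]) (simp_all add: power_mult_distrib, simp add: power2_eq_square)
      ultimately have "(?t * h q True + (1 - ?t) * h q False)\<^sup>2 = (2 * sqrt (?t * (1 - ?t)))\<^sup>2"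
        using True by (simp add: h_def)
      also have "\<dots> = 4 * (?t * (1 - ?t))" using \<theta>01[of \<pi> q] by (simp add: power_mult_distrib)
      also have "\<dots> = 1 - 4 * lam\<^sup>2" by (simp add: \<theta>_def power2_eq_square algebra_simps)
      finally show ?thesis using True by simp
    qed (simp add: h_def)
    then show "((?t * h q True + (1 - ?t) * h q False) ^ c q)\<^sup>2 =
        (if q \<in> D then 1 - 4 * lam\<^sup>2 else 1) ^ c q"
      by (simp add: power2_eq_square flip: power_mult_distrib)
  qed
  finally show ?thesis by (simp add: D_def)
qed

text \<open>The counts have the same law under both hypotheses, so the conditional bounds may be
  averaged; \<open>regular_sampling\<close> is used with \<open>x = 4 * lam\<^sup>2\<close>.\<close>

lemma observation_testing_lower_bound:
  assumes S: "regular_sampling n p S" and lam: "0 < lam" "lam < 1/2"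
    and \<pi>: "\<pi> permutes {1..n}" and \<sigma>: "\<sigma> permutes {1..n}"
  defines "M \<equiv> extremal_matrix lam"
  shows "exp (- (p * (4 * lam\<^sup>2) * card (discordant n \<pi> \<sigma>) / (1 - 4 * lam\<^sup>2))) / 2
    \<le> measure_pmf.prob (observation_law n S \<pi> M) A + measure_pmf.prob (observation_law n S \<sigma> M) (- A)"
proof -
  let ?g = "\<lambda>c. \<Prod>q\<in>item_pairs n. (if q \<in> discordant n \<pi> \<sigma> then 1 - 4 * lam\<^sup>2 else 1) ^ c q"
  have finS: "finite (set_pmf S)" using S by (simp add: regular_sampling_def)
  have int: "integrable (measure_pmf S) f" for f :: "(nat \<times> nat \<Rightarrow> nat) \<Rightarrow> real"
    using finS by (rule integrable_measure_pmf_finite)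
  have pr: "measure_pmf.prob (observation_law n S \<tau> M) B =
      expect S (\<lambda>c. measure_pmf.prob (outcomes n \<tau> M c) (observe c -` B))" for \<tau> B
  proof -
    have "measure_pmf.prob (observation_law n S \<tau> M) B = expect (observation_law n S \<tau> M) (indicator B)"
      by simp
    also have "\<dots> = expect S (\<lambda>c. expect (outcomes n \<tau> M c) (indicator (observe c -` B)))"
    proof -
      have "(\<lambda>w. indicator B (observe c w)) = (indicator (observe c -` B) :: _ \<Rightarrow> real)" for c
        by (auto simp: indicator_def fun_eq_iff)
      then show ?thesis unfolding expect_observation_law[OF finS] by simp
    qed
    finally show ?thesis by simp
  qed
  have "lam * lam < (1/2) * (1/2)" using lam by (intro mult_strict_mono) auto
  then have "4 * lam\<^sup>2 < 1" by (simp add: power2_eq_square)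
  then have "exp (- (p * (4 * lam\<^sup>2) * card (discordant n \<pi> \<sigma>) / (1 - 4 * lam\<^sup>2))) / 2 \<le> expect S ?g / 2"
  proof (intro divide_right_mono)
    have "\<forall>D x. D \<subseteq> item_pairs n \<and> 0 \<le> x \<and> x < 1 \<longrightarrow> exp (- (p * x * card D / (1 - x))) \<le>
          expect S (\<lambda>c. \<Prod>q\<in>item_pairs n. (if q \<in> D then 1 - x else 1) ^ c q)"
      using S unfolding regular_sampling_def by blast
    moreover have "discordant n \<pi> \<sigma> \<subseteq> item_pairs n" by (auto simp: discordant_def)
    ultimately show "exp (- (p * (4 * lam\<^sup>2) * card (discordant n \<pi> \<sigma>) / (1 - 4 * lam\<^sup>2))) \<le> expect S ?g"
      using \<open>4 * lam\<^sup>2 < 1\<close> by simp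
  qed simp
  also have "\<dots> = expect S (\<lambda>c. ?g c / 2)" by simp
  also have "\<dots> \<le> expect S (\<lambda>c. measure_pmf.prob (outcomes n \<pi> M c) (observe c -` A) +
      measure_pmf.prob (outcomes n \<sigma> M c) (observe c -` (- A)))"
    unfolding M_def vimage_Compl
    by (intro integral_mono int outcomes_testing_lower_bound lam \<pi> \<sigma>)
  also have "\<dots> = measure_pmf.prob (observation_law n S \<pi> M) A + measure_pmf.prob (observation_law n S \<sigma> M) (- A)"
    unfolding pr by (intro Bochner_Integration.integral_add int)
  finally show ?thesis .
qed

section \<open>Swapping two items under the uniform prior\<close>

lemma card_discordant_swap:
  assumes \<pi>: "\<pi> permutes {1..n}" and ij: "i \<in> {1..n}" "j \<in> {1..n}" "i \<noteq> j"
  shows "int (card (discordant n \<pi> (\<pi> \<circ> Transposition.transpose i j))) \<le> 4 * \<bar>int (\<pi> i) - int (\<pi> j)\<bar>"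
proof -
  let ?\<tau> = "Transposition.transpose i j"
  have \<sigma>: "\<pi> \<circ> ?\<tau> permutes {1..n}"
    using ij by (intro permutes_compose[OF permutes_swap_id \<pi>]) auto
  have "footrule n \<pi> (\<pi> \<circ> ?\<tau>) = (\<Sum>k\<in>{i, j}. \<bar>int (\<pi> k) - int ((\<pi> \<circ> ?\<tau>) k)\<bar>)"
    unfolding footrule_def using ij by (intro sum.mono_neutral_right) (auto simp: Transposition.transpose_def)
  also have "\<dots> = 2 * \<bar>int (\<pi> i) - int (\<pi> j)\<bar>" using ij(3) by simp
  finally show ?thesis
    using kendall_tau_le_footrule[OF \<pi> \<sigma>] kendall_tau_eq_card_discordant[OF \<pi> \<sigma>] by simp
qed

text \<open>Ranks \<open>a\<close> and \<open>a + d\<close> stay within \<open>n\<close> if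
  \<open>a\<close> and \<open>d\<close> are at most \<open>n div 2\<close>. The items holding them,
  sorted by label, form a pair from which \<open>g\<close> recovers \<open>(a, d)\<close>.\<close>

lemma card_near_pairs:
  assumes \<pi>: "\<pi> permutes {1..n}"
  shows "(n div 2) * min m (n div 2) \<le>
    card {q \<in> item_pairs n. \<bar>int (\<pi> (fst q)) - int (\<pi> (snd q))\<bar> \<le> int m}"
proof -
  let ?N = "{q \<in> item_pairs n. \<bar>int (\<pi> (fst q)) - int (\<pi> (snd q))\<bar> \<le> int m}"
  let ?X = "{1..n div 2} \<times> {1..min m (n div 2)}"
  define i where "i a = inv \<pi> a" for a
  define f where "f = (\<lambda>(a, d). (min (i a) (i (a + d)), max (i a) (i (a + d))))"
  define g where "g q = (min (\<pi> (fst q)) (\<pi> (snd q)),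
    max (\<pi> (fst q)) (\<pi> (snd q)) - min (\<pi> (fst q)) (\<pi> (snd q)))" for q
  have \<pi>i: "\<pi> (i a) = a" for a using permutes_inverses(1)[OF \<pi>] by (simp add: i_def)
  have i_in: "i a \<in> {1..n}" if "a \<in> {1..n}" for a
    unfolding i_def using permutes_in_image[OF permutes_inv[OF \<pi>]] that by blast
  have "inj_on f ?X"
  proof (rule inj_on_inverseI[of _ g])
    fix z assume "z \<in> ?X"
    then show "g (f z) = z"
      by (cases z) (auto simp: f_def g_def min_def max_def \<pi>i)
  qed
  moreover have "f ` ?X \<subseteq> ?N"
  proof
    fix q assume "q \<in> f ` ?X"
    then obtain a d where ad: "a \<in> {1..n div 2}" "d \<in> {1..min m (n div 2)}" and q: "q = f (a, d)" by auto
    have dm: "1 \<le> d" "d \<le> m" using ad by auto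
    have "a \<in> {1..n}" "a + d \<in> {1..n}" using ad by auto
    then have "i a \<in> {1..n}" "i (a + d) \<in> {1..n}" by (blast intro: i_in)+
    moreover have "i a \<noteq> i (a + d)" using \<pi>i[of a] \<pi>i[of "a + d"] ad by auto
    ultimately show "q \<in> ?N"
      using dm unfolding q f_def item_pairs_def by (auto simp: min_def max_def \<pi>i)
  qed
  moreover have "finite ?N" by simp
  ultimately have "card ?X \<le> card ?N" by (meson card_inj_on_le)
  then show ?thesis by (simp only: card_cartesian_product card_atLeastAtMost diff_Suc_1 add_diff_cancel_right' Suc_eq_plus1)
qed

text \<open>The worst risk dominates the average over permutations at the extremal matrix, which
  splits into misjudged pairs. Of the 1/4, one half is lost in testing and the other because the
  swap makes every error probability occur twice.\<close>

lemma worst_risk_lower: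
  fixes m :: nat
  assumes S: "regular_sampling n p S" and p: "0 < p" and lam: "0 < lam" "lam < 1/2"
    and est: "est \<in> estimators n"
  shows "exp (- (p * (4 * lam\<^sup>2) * (4 * m) / (1 - 4 * lam\<^sup>2))) / 4 * ((n div 2) * min m (n div 2))
    \<le> worst_risk n lam S est"
proof -
  define \<kappa> where "\<kappa> = exp (- (p * (4 * lam\<^sup>2) * (4 * m) / (1 - 4 * lam\<^sup>2)))"
  define M where "M = extremal_matrix lam"
  define Perm where "Perm = {\<pi>. \<pi> permutes {1..n}}"
  define pr where "pr \<pi> q = measure_pmf.prob (observation_law n S \<pi> M)
      {x. ranks_above (est x) q \<noteq> ranks_above \<pi> q}" for \<pi> q
  define near where "near \<pi> = {q \<in> item_pairs n. \<bar>int (\<pi> (fst q)) - int (\<pi> (snd q))\<bar> \<le> int m}" for \<pi> :: "nat \<Rightarrow> nat"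
  have M: "M \<in> comparison_matrices n lam" unfolding M_def using lam by (rule extremal_matrix_in)
  have finP: "finite Perm" by (simp add: Perm_def finite_permutations)
  have "id \<in> Perm" using permutes_id by (simp add: Perm_def)
  then have cardP: "0 < card Perm" using finP by (auto simp: card_gt_0_iff)
  have finS: "finite (set_pmf S)" using S by (simp add: regular_sampling_def)
  have "lam * lam < (1/2) * (1/2)" using lam by (intro mult_strict_mono) auto
  then have l1: "4 * lam\<^sup>2 < 1" by (simp add: power2_eq_square)
  have risk: "risk n S est \<pi> M = (\<Sum>q\<in>item_pairs n. pr \<pi> q)" if \<pi>: "\<pi> \<in> Perm" for \<pi>
  proof -
    have int: "integrable (measure_pmf (observation_law n S \<pi> M)) f" for f :: "observation \<Rightarrow> real"
      using finS by (intro integrable_measure_pmf_finite finite_set_pmf_observation_law)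
    have "real (kendall_tau n (est x) \<pi>) =
        (\<Sum>q\<in>item_pairs n. indicator {x. ranks_above (est x) q \<noteq> ranks_above \<pi> q} x)" for x
    proof -
      have "est x permutes {1..n}" using est unfolding estimators_def by blast
      then have "kendall_tau n (est x) \<pi> = card (discordant n (est x) \<pi>)"
        using \<pi> by (simp add: Perm_def kendall_tau_eq_card_discordant)
      also have "discordant n (est x) \<pi> = item_pairs n \<inter> {q. ranks_above (est x) q \<noteq> ranks_above \<pi> q}"
        by (auto simp: discordant_def)
      finally show ?thesis by (simp add: indicator_def)
    qed
    then have "risk n S est \<pi> M = expect (observation_law n S \<pi> M)
        (\<lambda>x. \<Sum>q\<in>item_pairs n. indicator {x. ranks_above (est x) q \<noteq> ranks_above \<pi> q} x)"
      unfolding risk_def by simp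
    also have "\<dots> = (\<Sum>q\<in>item_pairs n. expect (observation_law n S \<pi> M)
        (indicator {x. ranks_above (est x) q \<noteq> ranks_above \<pi> q}))"
      by (rule Bochner_Integration.integral_sum) (rule int)
    finally show ?thesis by (simp add: pr_def)
  qed
  have pair: "\<kappa> / 4 * (\<Sum>\<pi>\<in>Perm. of_bool (q \<in> near \<pi>)) \<le> (\<Sum>\<pi>\<in>Perm. pr \<pi> q)"
    if q: "q \<in> item_pairs n" for q
  proof -
    obtain i j where qij: "q = (i, j)" by fastforce
    have ij: "i \<in> {1..n}" "j \<in> {1..n}" "i \<noteq> j" using q qij by (auto simp: item_pairs_def)
    \<comment> \<open>An involution of the permutations, so it preserves the uniform prior and
      matches each hypothesis with an alternative.\<close>
    define sw where "sw \<pi> = \<pi> \<circ> Transposition.transpose i j" for \<pi> :: "nat \<Rightarrow> nat"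
    have sw_in: "sw \<pi> \<in> Perm" if "\<pi> \<in> Perm" for \<pi>
      using that ij unfolding Perm_def sw_def by (auto intro!: permutes_compose[OF permutes_swap_id])
    have sw_sw: "sw (sw \<pi>) = \<pi>" for \<pi> by (simp add: sw_def comp_assoc)
    have "bij_betw sw Perm Perm" by (rule bij_betw_byWitness[of _ sw]) (use sw_sw sw_in in auto)
    then have re: "(\<Sum>\<pi>\<in>Perm. pr (sw \<pi>) q) = (\<Sum>\<pi>\<in>Perm. pr \<pi> q)" by (rule sum.reindex_bij_betw)
    have pt: "\<kappa> / 2 * of_bool (q \<in> near \<pi>) \<le> pr \<pi> q + pr (sw \<pi>) q" if \<pi>: "\<pi> \<in> Perm" for \<pi>
    proof (cases "q \<in> near \<pi>")
      case False
      then show ?thesis by (simp add: pr_def)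
    next
      case True
      have perm: "\<pi> permutes {1..n}" "sw \<pi> permutes {1..n}" using \<pi> sw_in[OF \<pi>] by (auto simp: Perm_def)
      have "\<pi> i \<noteq> \<pi> j" using ij(3) by (simp add: inj_eq[OF permutes_inj[OF perm(1)]])
      then have flip: "ranks_above (sw \<pi>) q \<longleftrightarrow> \<not> ranks_above \<pi> q"
        by (auto simp: ranks_above_def sw_def qij)
      have "int (card (discordant n \<pi> (sw \<pi>))) \<le> 4 * int m"
        using card_discordant_swap[OF perm(1) ij] True by (simp add: sw_def near_def qij)
      then have cd: "real (card (discordant n \<pi> (sw \<pi>))) \<le> 4 * m" by linarith
      have "\<kappa> \<le> exp (- (p * (4 * lam\<^sup>2) * card (discordant n \<pi> (sw \<pi>)) / (1 - 4 * lam\<^sup>2)))"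
        unfolding \<kappa>_def unfolding exp_le_cancel_iff neg_le_iff_le
        using cd p l1 by (intro divide_right_mono mult_left_mono) auto
      then have "\<kappa> / 2 \<le> exp (- (p * (4 * lam\<^sup>2) * card (discordant n \<pi> (sw \<pi>)) / (1 - 4 * lam\<^sup>2))) / 2"
        by simp
      also have "\<dots> \<le> pr \<pi> q + measure_pmf.prob (observation_law n S (sw \<pi>) M)
          (- {x. ranks_above (est x) q \<noteq> ranks_above \<pi> q})"
        unfolding pr_def M_def by (rule observation_testing_lower_bound[OF S lam perm])
      \<comment> \<open>The swap reverses the order of the pair, so being right for
        \<open>\<pi>\<close> means being wrong for \<open>sw \<pi>\<close>: a single event is the
        test.\<close>
      also have "- {x. ranks_above (est x) q \<noteq> ranks_above \<pi> q} =
          {x. ranks_above (est x) q \<noteq> ranks_above (sw \<pi>) q}"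
        using flip by auto
      finally show ?thesis using True by (simp add: pr_def)
    qed
    have "\<kappa> / 2 * (\<Sum>\<pi>\<in>Perm. of_bool (q \<in> near \<pi>)) = (\<Sum>\<pi>\<in>Perm. \<kappa> / 2 * of_bool (q \<in> near \<pi>))"
      by (rule sum_distrib_left)
    also have "\<dots> \<le> (\<Sum>\<pi>\<in>Perm. pr \<pi> q + pr (sw \<pi>) q)" by (intro sum_mono pt)
    also have "\<dots> = 2 * (\<Sum>\<pi>\<in>Perm. pr \<pi> q)" by (simp add: sum.distrib re)
    finally show ?thesis by simp
  qed
  have "card Perm * (\<kappa> / 4 * ((n div 2) * min m (n div 2))) = (\<Sum>\<pi>\<in>Perm. \<kappa> / 4 * ((n div 2) * min m (n div 2)))"
    by simp
  also have "\<dots> \<le> (\<Sum>\<pi>\<in>Perm. \<kappa> / 4 * card (near \<pi>))"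
  proof (rule sum_mono)
    fix \<pi> assume "\<pi> \<in> Perm"
    then have "(n div 2) * min m (n div 2) \<le> card (near \<pi>)"
      unfolding near_def Perm_def by (intro card_near_pairs) auto
    then show "\<kappa> / 4 * ((n div 2) * min m (n div 2)) \<le> \<kappa> / 4 * card (near \<pi>)"
      by (intro mult_left_mono) (auto simp: \<kappa>_def simp flip: of_nat_mult)
  qed
  also have "\<dots> = (\<Sum>\<pi>\<in>Perm. \<Sum>q\<in>item_pairs n. \<kappa> / 4 * of_bool (q \<in> near \<pi>))"
  proof (rule sum.cong[OF refl])
    fix \<pi>
    have "near \<pi> = item_pairs n \<inter> {q. q \<in> near \<pi>}" by (auto simp: near_def)
    then have "real (card (near \<pi>)) = (\<Sum>q\<in>item_pairs n. of_bool (q \<in> near \<pi>))"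
      by (metis finite_item_pairs of_nat_sum sum_of_bool_eq of_nat_of_bool)
    then show "\<kappa> / 4 * card (near \<pi>) = (\<Sum>q\<in>item_pairs n. \<kappa> / 4 * of_bool (q \<in> near \<pi>))"
      by (simp only: sum_distrib_left)
  qed
  also have "\<dots> = (\<Sum>q\<in>item_pairs n. \<kappa> / 4 * (\<Sum>\<pi>\<in>Perm. of_bool (q \<in> near \<pi>)))"
    unfolding sum_distrib_left by (rule sum.swap)
  also have "\<dots> \<le> (\<Sum>q\<in>item_pairs n. \<Sum>\<pi>\<in>Perm. pr \<pi> q)" by (intro sum_mono pair)
  also have "\<dots> = (\<Sum>\<pi>\<in>Perm. risk n S est \<pi> M)"
    by (subst sum.swap) (simp add: risk)
  also have "\<dots> \<le> (\<Sum>\<pi>\<in>Perm. worst_risk n lam S est)"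
  proof (rule sum_mono)
    fix \<pi> assume \<pi>: "\<pi> \<in> Perm"
    have "risk n S est \<pi> M = (\<lambda>(\<pi>, M). risk n S est \<pi> M) (\<pi>, M)" by simp
    also have "\<dots> \<le> worst_risk n lam S est"
      unfolding worst_risk_def using M \<pi>
      by (intro cSUP_upper bdd_above_risk) (auto simp: Perm_def)
    finally show "risk n S est \<pi> M \<le> worst_risk n lam S est" .
  qed
  also have "\<dots> = card Perm * worst_risk n lam S est" by simp
  finally show ?thesis using cardP by (simp add: \<kappa>_def)
qed

text \<open>\<open>m\<close> is of the largest order for which a swap stays undetectable: the
  exponent is at most \<open>16 / (2 * c) = 8 / c\<close>. The 36 combines the 1/4 of the averaged
  risk with a 9 from counting near pairs.\<close>

lemma minimax_risk_lower:
  assumes n: "2 \<le> n" and p: "0 < p" "p \<le> 1" and c: "0 < c" and lam: "0 < lam" "lam \<le> 1/2 - c"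
    and S: "regular_sampling n p S"
  shows "exp (- (8 / c)) / 36 * min (n / (p * lam\<^sup>2)) ((real n)\<^sup>2) \<le> minimax_risk n lam S"
proof -
  define B where "B = 1 / (p * lam\<^sup>2)"
  define m where "m = nat \<lfloor>B\<rfloor>"
  have lam': "lam < 1/2" using c lam by simp
  have "lam\<^sup>2 \<le> 1" using lam lam' by (simp add: power_le_one)
  then have "p * lam\<^sup>2 \<le> 1 * 1" using p by (intro mult_mono) auto
  then have B1: "1 \<le> B" using p lam by (simp add: B_def)
  then have "1 \<le> \<lfloor>B\<rfloor>" by simp
  then have "real m = of_int \<lfloor>B\<rfloor>" by (simp add: m_def)
  then have mB: "real m \<le> B" "B / 2 \<le> real m" using \<open>1 \<le> \<lfloor>B\<rfloor>\<close> by linarith+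
  have "lam\<^sup>2 \<le> (1/2 - c)\<^sup>2" using lam by (intro power_mono) auto
  moreover have "c * c \<le> c * (1/2)" using c lam by (intro mult_left_mono) auto
  ultimately have gap: "2 * c \<le> 1 - 4 * lam\<^sup>2" by (simp add: power2_eq_square algebra_simps)
  have "p * (4 * lam\<^sup>2) * (4 * m) / (1 - 4 * lam\<^sup>2) \<le> 16 / (2 * c)"
  proof (rule frac_le)
    have "p * lam\<^sup>2 * m \<le> p * lam\<^sup>2 * B" using mB p by (intro mult_left_mono) auto
    also have "\<dots> = 1" using p lam by (simp add: B_def)
    finally show "p * (4 * lam\<^sup>2) * (4 * m) \<le> 16" by simp
  qed (use c gap in auto)
  then have \<kappa>: "exp (- (8 / c)) \<le> exp (- (p * (4 * lam\<^sup>2) * (4 * m) / (1 - 4 * lam\<^sup>2)))" by simp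
  \<comment> \<open>Equality holds at \<open>n = 3\<close>. Used for both factors of the pair count,
    it gives the 9.\<close>
  have "n \<le> 3 * (n div 2)" using n by presburger
  then have half: "n / 3 \<le> real (n div 2)" by linarith
  have "min (n / (p * lam\<^sup>2)) ((real n)\<^sup>2) / 9 \<le> n / 3 * min (B / 2) (n / 3)"
  proof (cases "B / 2 \<le> n / 3")
    case True
    have "0 \<le> n * B" using B1 by simp
    then show ?thesis using True by (simp add: B_def min_def)
  next
    case False
    then show ?thesis by (simp add: min_def power2_eq_square)
  qed
  also have "\<dots> \<le> real (n div 2) * min (real m) (real (n div 2))"
    using half mB B1 by (intro mult_mono min.mono) auto
  finally have count: "min (n / (p * lam\<^sup>2)) ((real n)\<^sup>2) / 9 \<le> real ((n div 2) * min m (n div 2))"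
    by (simp only: of_nat_mult of_nat_min)
  show ?thesis
    unfolding minimax_risk_def
  proof (rule cINF_greatest)
    have "(\<lambda>_. id) \<in> estimators n" by (simp add: estimators_def permutes_id)
    then show "estimators n \<noteq> {}" by blast
    fix est assume "est \<in> estimators n"
    note worst_risk_lower[OF S p(1) lam(1) lam' this, of m]
    moreover have "exp (- (8 / c)) / 4 * (min (n / (p * lam\<^sup>2)) ((real n)\<^sup>2) / 9) \<le>
      exp (- (p * (4 * lam\<^sup>2) * (4 * m) / (1 - 4 * lam\<^sup>2))) / 4 * real ((n div 2) * min m (n div 2))"
      using \<kappa> count p lam by (intro mult_mono) auto
    ultimately show "exp (- (8 / c)) / 36 * min (n / (p * lam\<^sup>2)) ((real n)\<^sup>2) \<le> worst_risk n lam S est"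
      by simp
  qed
qed

theorem theorem1:
  fixes c :: real
  assumes "0 < c" and "c < 1/2"
  shows "\<exists>K1 K2 :: real. 0 < K1 \<and> K1 \<le> K2 \<and>
    (\<forall>(n::nat) (lam::real). n \<ge> 2 \<and> 0 < lam \<and> lam \<le> 1/2 - c \<longrightarrow>
      (\<forall>p::real. 0 < p \<and> p \<le> 1 \<longrightarrow>
         K1 * min (real n / (p * lam\<^sup>2)) ((real n)\<^sup>2) \<le> minimax_risk n lam (sampling_O1 n p) \<and>
         minimax_risk n lam (sampling_O1 n p) \<le> K2 * min (real n / (p * lam\<^sup>2)) ((real n)\<^sup>2)) \<and>
      (\<forall>N::nat. 1 \<le> N \<and> N \<le> n choose 2 \<longrightarrow>
         K1 * min ((real n)^3 / (real N * lam\<^sup>2)) ((real n)\<^sup>2) \<le> minimax_risk n lam (sampling_O2 n N) \<and>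
         minimax_risk n lam (sampling_O2 n N) \<le> K2 * min ((real n)^3 / (real N * lam\<^sup>2)) ((real n)\<^sup>2)))"
proof -
  \<comment> \<open>\<open>144 = 4 * 36\<close>; the 4 covers sampling with replacement, where
    \<open>n * (n choose 2)\<close> lies between \<open>n ^ 3 / 4\<close> and
    \<open>n ^ 3\<close>.\<close>
  define K :: real where "K = exp (- (8 / c)) / 144"
  have K: "0 < K" "4 * K = exp (- (8 / c)) / 36" by (simp_all add: K_def)
  have "exp (- (8 / c)) \<le> 1" using assms by simp
  then have "K \<le> 60552" unfolding K_def by linarith
  moreover have "K * min (n / (p * lam\<^sup>2)) ((real n)\<^sup>2) \<le> minimax_risk n lam (sampling_O1 n p) \<and>
      minimax_risk n lam (sampling_O1 n p) \<le> 60552 * min (n / (p * lam\<^sup>2)) ((real n)\<^sup>2)"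
    if n: "n \<ge> 2" and lam: "0 < lam" "lam \<le> 1/2 - c" and p: "0 < p" "p \<le> 1" for n lam p
  proof
    have reg: "regular_sampling n p (sampling_O1 n p)" using p by (rule regular_sampling_O1)
    have "K * min (n / (p * lam\<^sup>2)) ((real n)\<^sup>2) \<le> 4 * K * min (n / (p * lam\<^sup>2)) ((real n)\<^sup>2)"
      using K(1) p lam by (intro mult_right_mono) auto
    also have "\<dots> \<le> minimax_risk n lam (sampling_O1 n p)"
      unfolding K(2) using n p assms(1) lam reg by (rule minimax_risk_lower)
    finally show "K * min (n / (p * lam\<^sup>2)) ((real n)\<^sup>2) \<le> minimax_risk n lam (sampling_O1 n p)" .
    show "minimax_risk n lam (sampling_O1 n p) \<le> 60552 * min (n / (p * lam\<^sup>2)) ((real n)\<^sup>2)"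
      using n p lam assms(1) reg by (intro minimax_risk_upper) auto
  qed
  moreover have "K * min ((real n)^3 / (real N * lam\<^sup>2)) ((real n)\<^sup>2) \<le> minimax_risk n lam (sampling_O2 n N) \<and>
      minimax_risk n lam (sampling_O2 n N) \<le> 60552 * min ((real n)^3 / (real N * lam\<^sup>2)) ((real n)\<^sup>2)"
    if n: "n \<ge> 2" and lam: "0 < lam" "lam \<le> 1/2 - c" and N: "1 \<le> N" "N \<le> n choose 2" for n N lam
  proof
    define p where "p = N / (n choose 2)"
    let ?Z = "(real n)^3 / (real N * lam\<^sup>2)"
    have pos: "0 < real (n choose 2)" using n by simp
    have p: "0 < p" "p \<le> 1" using N pos by (simp_all add: p_def)
    have reg: "regular_sampling n p (sampling_O2 n N)"
      unfolding p_def using n by (rule regular_sampling_O2)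
    have ch: "real (n choose 2) = n * (real n - 1) / 2"
      using n by (simp add: choose_two real_of_nat_div of_nat_diff)
    have "n / (p * lam\<^sup>2) = n * real (n choose 2) / (N * lam\<^sup>2)" by (simp add: p_def)
    also have "\<dots> = (n * n * (real n - 1) / 2) / (N * lam\<^sup>2)" unfolding ch by simp
    finally have eq: "n / (p * lam\<^sup>2) = (n * n * (real n - 1) / 2) / (N * lam\<^sup>2)" .
    have "(real n * n) * (n / 4) \<le> (real n * n) * ((real n - 1) / 2)"
      "(real n * n) * ((real n - 1) / 2) \<le> (real n * n) * n"
      using n by (intro mult_left_mono; simp)+
    then have cube: "(real n)^3 / 4 \<le> n * n * (real n - 1) / 2" "n * n * (real n - 1) / 2 \<le> (real n)^3"
      by (simp_all add: power3_eq_cube)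
    have "0 \<le> real N * lam\<^sup>2" by simp
    then have "(real n)^3 / 4 / (N * lam\<^sup>2) \<le> n / (p * lam\<^sup>2)" "n / (p * lam\<^sup>2) \<le> ?Z"
      unfolding eq using cube by (auto intro: divide_right_mono simp del: divide_divide_eq_left)
    then have Z: "?Z / 4 \<le> n / (p * lam\<^sup>2)" "n / (p * lam\<^sup>2) \<le> ?Z" by simp_all
    have "min ?Z ((real n)\<^sup>2) / 4 \<le> min (n / (p * lam\<^sup>2)) ((real n)\<^sup>2)"
    proof -
      have "min a b / 4 \<le> min a' b" if "a / 4 \<le> a'" "0 \<le> b" for a a' b :: real
        using that by (auto simp: min_def)
      from this[OF Z(1)] show ?thesis by simp
    qed
    then have "4 * K * (min ?Z ((real n)\<^sup>2) / 4) \<le> 4 * K * min (n / (p * lam\<^sup>2)) ((real n)\<^sup>2)"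
      using K(1) by (intro mult_left_mono) auto
    also have "\<dots> \<le> minimax_risk n lam (sampling_O2 n N)"
      unfolding K(2) using n p assms(1) lam reg by (rule minimax_risk_lower)
    finally show "K * min ?Z ((real n)\<^sup>2) \<le> minimax_risk n lam (sampling_O2 n N)" by simp
    have "minimax_risk n lam (sampling_O2 n N) \<le> 60552 * min (n / (p * lam\<^sup>2)) ((real n)\<^sup>2)"
      using n p lam assms(1) reg by (intro minimax_risk_upper) auto
    also have "\<dots> \<le> 60552 * min ?Z ((real n)\<^sup>2)"
      using Z(2) by (intro mult_left_mono min.mono) auto
    finally show "minimax_risk n lam (sampling_O2 n N) \<le> 60552 * min ?Z ((real n)\<^sup>2)" .
  qed
  ultimately show ?thesis using K(1) by blast
qed

end
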